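(* Let $d\ge 1$ and let $a\in C^1(0,\infty)$, $a\ge 0$, be a function $a:(0,\infty)\to(0,\infty)$ for which there exist $a_0>0$ and $p\ge 0$ such that for all $r>0$, $$a(r)\ge r|a'(r)|,\qquad a(r)\ge \frac{a_0}{r^p+r^{-p}}.$$ Let $\alpha\ge p+4$, $\mu_1=\mu_2=0$, and let $u^0=(u_1^0,u_2^0)\in L^2(\mathbb{T}^d)^2$ with $u_1^0,u_2^0\ge 0$ in $\mathbb{T}^d$ and $H[u^0]<\infty$, where $H$ is defined in the context. Let $u=(u_1,u_2)$ be a solution (in the sense described in the context) on $(0,\infty)$ to $$\partial_t u_i=\Delta\big(a(u_1/u_2)u_i\big),\quad t>0,\qquad u_i(0)=u_i^0\quad\text{in }\mathbb{T}^d,\quad i=1,2.$$ Then $u(t)=(u_1,u_2)(t)$ converges in $L^2(\mathbb{T}^d)$ to $\overline{u}=(\overline{u}_1,\overline{u}_2)$ as $t\to\infty$, where $$\overline{u}_i=\frac{1}{\mathrm{meas}(\mathbb{T}^d)}\int_{\mathbb{T}^d}u_i^0\,dx,\quad i=1,2.$$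
   Context: $\mathbb{T}^d$ is the $d$-dimensional torus. $H^1(\mathbb{T}^d)'$ is the dual of $H^1(\mathbb{T}^d)$. The entropy functional is $$H[u]=\int_{\mathbb{T}^d}h(u)\,dx,\qquad h(u)=\Big(\frac{u_1}{u_2}\Big)^{\alpha}u_1^2+\Big(\frac{u_1}{u_2}\Big)^{-\alpha}u_2^2+u_1-\log u_1+u_2-\log u_2$$ for $u=(u_1,u_2)\in(0,\infty)^2$, with the convention $h(u)=+\infty$ if $u_1=0$ or $u_2=0$. The solution meant is a weak solution of the kind furnished by the paper's existence theorem, i.e. $u_i>0$ a.e. in $\mathbb{T}^d\times(0,\infty)$ and, for $i=1,2$, $$u_i,\ a(u_1/u_2)u_i\in L^\infty(0,\infty;L^2(\mathbb{T}^d)),\qquad \nabla u_i,\ \nabla\big(a(u_1/u_2)u_i\big)\in L^2(0,\infty;L^2(\mathbb{T}^d)),$$ $\partial_t u_i\in L^2(0,T;H^1(\mathbb{T}^d)')$ for every $T>0$, and for every $T>0$ and all $\phi\in L^2(0,T;H^1(\mathbb{T}^d))$, $$\int_0^T\langle\partial_t u_i,\phi\rangle\,dt+\int_0^T\int_{\mathbb{T}^d}\nabla\big(a(u_1/u_2)u_i\big)\cdot\nabla\phi\,dx\,dt=0,$$ with $\langle\cdot,\cdot\rangle$ the duality pairing of $H^1(\mathbb{T}^d)'$ and $H^1(\mathbb{T}^d)$, and $u_i(0)=u_i^0$ in $L^2(\mathbb{T}^d)$. By this regularity $u_i\in C^0([0,\infty);L^2(\mathbb{T}^d))$, and $u_i(t)$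 denotes the continuous representative. *)

theory Defs
  imports "HOL-Analysis.Analysis"
begin

section \<open>The torus and its function spaces\<close>

text \<open>The torus is \<open>\<real>\<^sup>d / \<int>\<^sup>d\<close> with \<open>d = CARD('n)\<close>. A function on it is given by its values on
  the fundamental cell \<open>[0,1)\<^sup>d\<close>; values outside the cell are irrelevant everywhere below. Smooth
  functions on the torus, for which the cell alone would not do, are smooth \<open>\<int>\<^sup>d\<close>-periodic functions
  on \<open>\<real>\<^sup>d\<close>. Elements of Lebesgue, Sobolev and Bochner spaces are represented by functions, norms are
  accordingly seminorms, and every notion below is invariant under changes on null sets.\<close>

definition torus :: "(real ^ 'n) measure" where
  "torus = lebesgue_on {x. \<forall>i. 0 \<le> x $ i \<and> x $ i < 1}"

definition torus_mean :: "(real ^ 'n \<Rightarrow> real) \<Rightarrow> real" where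
  "torus_mean f = 1 / measure torus (space (torus :: (real ^ 'n) measure)) * (\<integral>x. f x \<partial>torus)"

definition L2 :: "(real ^ 'n \<Rightarrow> 'b::euclidean_space) set" where
  "L2 = {f \<in> borel_measurable torus. integrable torus (\<lambda>x. (norm (f x))\<^sup>2)}"

definition norm_L2 :: "(real ^ 'n \<Rightarrow> 'b::euclidean_space) \<Rightarrow> real" where
  "norm_L2 f = sqrt (\<integral>x. (norm (f x))\<^sup>2 \<partial>torus)"

primrec C_k :: "nat \<Rightarrow> ('a::real_normed_vector \<Rightarrow> real) \<Rightarrow> bool" where
  "C_k 0 f \<longleftrightarrow> continuous_on UNIV f"
| "C_k (Suc k) f \<longleftrightarrow>
     (\<exists>f'. (\<forall>x. (f has_derivative f' x) (at x)) \<and> (\<forall>v. C_k k (\<lambda>x. f' x v)))"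

definition smooth :: "('a::real_normed_vector \<Rightarrow> real) \<Rightarrow> bool" where
  "smooth f \<longleftrightarrow> (\<forall>k. C_k k f)"

definition periodic :: "(real ^ 'n \<Rightarrow> real) \<Rightarrow> bool" where
  "periodic f \<longleftrightarrow> (\<forall>x i. f (x + axis i 1) = f x)"

definition is_weak_gradient :: "(real ^ 'n \<Rightarrow> real) \<Rightarrow> (real ^ 'n \<Rightarrow> real ^ 'n) \<Rightarrow> bool" where
  "is_weak_gradient f g \<longleftrightarrow>
     (\<forall>\<eta>. smooth \<eta> \<and> periodic \<eta> \<longrightarrow>
       (\<forall>i. (\<integral>x. f x * frechet_derivative \<eta> (at x) (axis i 1) \<partial>torus)
          = - (\<integral>x. g x $ i * \<eta> x \<partial>torus)))"

definition H1 :: "(real ^ 'n \<Rightarrow> real) set" where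
  "H1 = {f \<in> L2. \<exists>g \<in> L2. is_weak_gradient f g}"

text \<open>The choice is unique up to null sets when \<open>f \<in> H1\<close>; elsewhere \<open>wgrad\<close> is unspecified.\<close>

definition wgrad :: "(real ^ 'n \<Rightarrow> real) \<Rightarrow> real ^ 'n \<Rightarrow> real ^ 'n" where
  "wgrad f = (SOME g. g \<in> L2 \<and> is_weak_gradient f g)"

definition norm_H1 :: "(real ^ 'n \<Rightarrow> real) \<Rightarrow> real" where
  "norm_H1 f = sqrt ((norm_L2 f)\<^sup>2 + (norm_L2 (wgrad f))\<^sup>2)"

text \<open>Bounded linear functionals on \<open>H1\<close>; by boundedness they respect equality almost everywhere.
  The duality pairing is application.\<close>

definition H1_dual :: "((real ^ 'n \<Rightarrow> real) \<Rightarrow> real) set" where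
  "H1_dual = {\<xi>.
     (\<forall>f\<in>H1. \<forall>g\<in>H1. \<forall>a b. \<xi> (\<lambda>x. a * f x + b * g x) = a * \<xi> f + b * \<xi> g) \<and>
     (\<exists>C. \<forall>f\<in>H1. \<bar>\<xi> f\<bar> \<le> C * norm_H1 f)}"

definition norm_H1_dual :: "((real ^ 'n \<Rightarrow> real) \<Rightarrow> real) \<Rightarrow> real" where
  "norm_H1_dual \<xi> = Sup {\<bar>\<xi> f\<bar> | f. f \<in> H1 \<and> norm_H1 f \<le> 1}"


section \<open>Bochner spaces\<close>

text \<open>Here \<open>X\<close> is a space of functions with seminorm \<open>N\<close>, and \<open>I\<close> is a time interval.
  Strong measurability is almost everywhere approximability by \<open>X\<close>-valued simple functions.\<close>

definition strongly_measurable ::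
  "real set \<Rightarrow> ('a \<Rightarrow> 'b::ab_group_add) set \<Rightarrow> (('a \<Rightarrow> 'b) \<Rightarrow> real) \<Rightarrow> (real \<Rightarrow> 'a \<Rightarrow> 'b) \<Rightarrow> bool"
where
  "strongly_measurable I X N f \<longleftrightarrow>
     (AE t in lebesgue_on I. f t \<in> X) \<and>
     (\<exists>s. (\<forall>n::nat. simple_function (lebesgue_on I) (s n) \<and> (\<forall>t\<in>I. s n t \<in> X)) \<and>
          (AE t in lebesgue_on I. (\<lambda>n. N (\<lambda>x. s n t x - f t x)) \<longlonglongrightarrow> 0))"

definition Bochner_L2 ::
  "real set \<Rightarrow> ('a \<Rightarrow> 'b::ab_group_add) set \<Rightarrow> (('a \<Rightarrow> 'b) \<Rightarrow> real) \<Rightarrow> (real \<Rightarrow> 'a \<Rightarrow> 'b) set"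
where
  "Bochner_L2 I X N =
     {f. strongly_measurable I X N f \<and> integrable (lebesgue_on I) (\<lambda>t. (N (f t))\<^sup>2)}"

definition Bochner_Linf ::
  "real set \<Rightarrow> ('a \<Rightarrow> 'b::ab_group_add) set \<Rightarrow> (('a \<Rightarrow> 'b) \<Rightarrow> real) \<Rightarrow> (real \<Rightarrow> 'a \<Rightarrow> 'b) set"
where
  "Bochner_Linf I X N =
     {f. strongly_measurable I X N f \<and> (\<exists>C. AE t in lebesgue_on I. N (f t) \<le> C)}"

definition test_function :: "real \<Rightarrow> (real \<Rightarrow> real) \<Rightarrow> bool" where
  "test_function T \<psi> \<longleftrightarrow>
     smooth \<psi> \<and> (\<exists>K. compact K \<and> K \<subseteq> {0<..<T} \<and> (\<forall>t. t \<notin> K \<longrightarrow> \<psi> t = 0))"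

text \<open>\<open>\<xi> = \<partial>\<^sub>t u\<close> in the distributional sense on \<open>(0,T)\<close>, with values in the dual of \<open>H1\<close>, into which
  \<open>L2\<close> is embedded by the \<open>L2\<close> inner product: the identity \<open>\<integral> \<psi>' u dt = - \<integral> \<psi> \<xi> dt\<close> in the dual,
  written out by evaluating both sides at every \<open>\<eta> \<in> H1\<close>.\<close>

definition is_weak_time_derivative ::
  "real \<Rightarrow> (real \<Rightarrow> real ^ 'n \<Rightarrow> real) \<Rightarrow> (real \<Rightarrow> (real ^ 'n \<Rightarrow> real) \<Rightarrow> real) \<Rightarrow> bool"
where
  "is_weak_time_derivative T u \<xi> \<longleftrightarrow>
     (\<forall>\<psi>. test_function T \<psi> \<longrightarrow>
       (\<forall>\<eta>\<in>H1. (\<integral>t. deriv \<psi> t * (\<integral>x. u t x * \<eta> x \<partial>torus) \<partial>lebesgue_on {0<..<T})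
             = - (\<integral>t. \<psi> t * \<xi> t \<eta> \<partial>lebesgue_on {0<..<T})))"

text \<open>\<open>v \<in> C\<^sup>0([0,\<infinity>); L2)\<close> is the continuous representative of \<open>u\<close>.\<close>

definition continuous_representative ::
  "(real \<Rightarrow> real ^ 'n \<Rightarrow> real) \<Rightarrow> (real \<Rightarrow> real ^ 'n \<Rightarrow> real) \<Rightarrow> bool"
where
  "continuous_representative u v \<longleftrightarrow>
     (\<forall>t\<ge>0. v t \<in> L2) \<and>
     (\<forall>t\<ge>0. ((\<lambda>s. norm_L2 (\<lambda>x. v s x - v t x)) \<longlongrightarrow> 0) (at t within {0..})) \<and>
     (AE t in lebesgue_on {0<..}. AE x in torus. v t x = u t x)"


section \<open>Entropy and weak solutions\<close>

text \<open>In \<open>entropy_density\<close> the real expression is positive, since \<open>s - ln s \<ge> 1\<close> for \<open>s > 0\<close>; so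
  \<open>ennreal\<close> truncates nothing, and the nonnegative integral is the integral of the entropy.\<close>

definition entropy_density :: "real \<Rightarrow> real \<Rightarrow> real \<Rightarrow> ennreal" where
  "entropy_density \<alpha> s1 s2 =
     (if s1 > 0 \<and> s2 > 0
      then ennreal ((s1 / s2) powr \<alpha> * s1\<^sup>2 + (s1 / s2) powr (- \<alpha>) * s2\<^sup>2
                    + s1 - ln s1 + s2 - ln s2)
      else \<infinity>)"

definition entropy :: "real \<Rightarrow> (real ^ 'n \<Rightarrow> real) \<Rightarrow> (real ^ 'n \<Rightarrow> real) \<Rightarrow> ennreal" where
  "entropy \<alpha> f1 f2 = (\<integral>\<^sup>+x. entropy_density \<alpha> (f1 x) (f2 x) \<partial>torus)"

text \<open>\<open>\<partial>\<^sub>t u = \<Delta> w\<close>, \<open>u(0) = u0\<close>, weakly on \<open>(0,\<infinity>)\<close>, in the regularity class of the problem.\<close>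

definition weak_equation ::
  "(real \<Rightarrow> real ^ 'n \<Rightarrow> real) \<Rightarrow> (real \<Rightarrow> real ^ 'n \<Rightarrow> real) \<Rightarrow> (real ^ 'n \<Rightarrow> real) \<Rightarrow> bool"
where
  "weak_equation u w u0 \<longleftrightarrow>
     (\<forall>f\<in>{u, w}. f \<in> Bochner_Linf {0<..} L2 norm_L2 \<and>
                 (AE t in lebesgue_on {0<..}. f t \<in> H1) \<and>
                 (\<lambda>t. wgrad (f t)) \<in> Bochner_L2 {0<..} L2 norm_L2) \<and>
     (\<exists>\<xi>. \<forall>T>0.
        \<xi> \<in> Bochner_L2 {0<..<T} H1_dual norm_H1_dual \<and>
        is_weak_time_derivative T u \<xi> \<and>
        (\<forall>\<phi> \<in> Bochner_L2 {0<..<T} H1 norm_H1.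
           (\<integral>t. \<xi> t (\<phi> t) \<partial>lebesgue_on {0<..<T})
         + (\<integral>t. (\<integral>x. wgrad (w t) x \<bullet> wgrad (\<phi> t) x \<partial>torus) \<partial>lebesgue_on {0<..<T}) = 0)) \<and>
     (\<exists>v. continuous_representative u v \<and> (AE x in torus. v 0 x = u0 x))"

text \<open>Positivity almost everywhere on space-time is stated with iterated null sets, which, unlike
  null sets of the product, do not depend on the representative of an element of a Bochner space
  (and agree with them for jointly measurable representatives).\<close>

definition weak_solution ::
  "(real \<Rightarrow> real) \<Rightarrow> (real ^ 'n \<Rightarrow> real) \<Rightarrow> (real ^ 'n \<Rightarrow> real)
    \<Rightarrow> (real \<Rightarrow> real ^ 'n \<Rightarrow> real) \<Rightarrow> (real \<Rightarrow> real ^ 'n \<Rightarrow> real) \<Rightarrow> bool"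
where
  "weak_solution a u01 u02 u1 u2 \<longleftrightarrow>
     (AE t in lebesgue_on {0<..}. AE x in torus. u1 t x > 0 \<and> u2 t x > 0) \<and>
     weak_equation u1 (\<lambda>t x. a (u1 t x / u2 t x) * u1 t x) u01 \<and>
     weak_equation u2 (\<lambda>t x. a (u1 t x / u2 t x) * u2 t x) u02"

end

theory Submission
  imports Defs
begin

text \<open>Each component solves \<open>\<partial>\<^sub>t u = \<Delta> w\<close> weakly, where \<open>\<nabla>u\<close> and \<open>\<nabla>w\<close> are square integrable over space-time,
  and each is treated on its own. Testing with the constant \<open>1\<close> shows that the mean \<open>m\<close> of \<open>u(t)\<close>
  does not depend on \<open>t\<close>. Let \<open>f(t) = \<parallel>u(t) - m\<parallel>\<^sup>2\<close>. By the Poincare inequality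
  \<open>f \<le> \<parallel>\<nabla>u\<parallel>\<^sup>2\<close>, which is integrable in time, and formally \<open>f' = - 2 \<integral> \<nabla>w \<bullet> \<nabla>u dx\<close>, which is integrable
  as well. A function that is integrable together with its derivative tends to \<open>0\<close>.
  
  The chain rule behind the formula for \<open>f'\<close> is replaced by finite increments. For times \<open>r < s\<close> with
  \<open>u(r)\<close> and \<open>u(s)\<close> weakly differentiable, the weak equation tested with \<open>u(r) + u(s)\<close> gives
  \<open>f(s) - f(r) = - \<integral>\<^sub>r\<^sup>s \<integral> \<nabla>w(\<tau>) \<bullet> (\<nabla>u(r) + \<nabla>u(s)) dx d\<tau>\<close>
  (\<open>increment\<close>, \<open>norm_square_increment\<close>). Choosing in each interval \<open>(t + 2\<^sup>-\<^sup>j\<^sup>-\<^sup>1, t + 2\<^sup>-\<^sup>j)\<close> a time at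
  which \<open>\<parallel>\<nabla>u\<parallel>\<^sup>2\<close> is at most its mean over the interval, and telescoping towards \<open>t\<close>, bounds \<open>f(t)\<close> by a
  multiple of \<open>\<integral> \<parallel>\<nabla>u\<parallel>\<^sup>2 + \<parallel>\<nabla>w\<parallel>\<^sup>2\<close> over \<open>(t, t + 1)\<close> (\<open>dyadic_decay\<close>, \<open>variance_bound\<close>); this tends to
  \<open>0\<close> because the integral over all times is finite.
  
  The Poincare inequality and the uniqueness of weak gradients both come from Fourier series: a weak
  gradient multiplies the coefficient of index \<open>k\<close> by \<open>2 \<pi> \<i> k\<close> (\<open>fourier_weak_gradient\<close>), and the
  trigonometric polynomials are dense in \<open>L2\<close> (\<open>approximable_L2\<close>, from Stone-Weierstrass). The passage
  from the distributional time derivative to increments (\<open>weak_derivative_increment\<close>) uses smoothed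
  indicator functions of time intervals as test functions.\<close>

section \<open>Square integrable functions\<close>

lemma square_integrable_inner:
  fixes f g :: "'a \<Rightarrow> 'b::euclidean_space"
  assumes [measurable]: "f \<in> borel_measurable M" "g \<in> borel_measurable M"
    and "integrable M (\<lambda>x. (norm (f x))\<^sup>2)" "integrable M (\<lambda>x. (norm (g x))\<^sup>2)"
  shows "integrable M (\<lambda>x. f x \<bullet> g x)"
proof (rule Bochner_Integration.integrable_bound)
  show "integrable M (\<lambda>x. (norm (f x))\<^sup>2 + (norm (g x))\<^sup>2)" using assms by simp
  have "\<bar>a \<bullet> b\<bar> \<le> (norm a)\<^sup>2 + (norm b)\<^sup>2" for a b :: 'b
  proof -
    have "\<bar>a \<bullet> b\<bar> \<le> norm a * norm b" by (rule Cauchy_Schwarz_ineq2)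
    moreover have "0 \<le> norm a * norm b" by simp
    ultimately show ?thesis using sum_squares_bound[of "norm a" "norm b"] by linarith
  qed
  then show "AE x in M. norm (f x \<bullet> g x) \<le> norm ((norm (f x))\<^sup>2 + (norm (g x))\<^sup>2)"
    by (auto intro!: AE_I2)
qed measurable

text \<open>This expansion in powers of \<open>c\<close> serves twice: it is nonnegative for every \<open>c\<close>, which is the
  Cauchy-Schwarz inequality, and for \<open>c = 1\<close> it relates the variance to the norm.\<close>

lemma square_integrable_scaleR_diff:
  fixes f g :: "'a \<Rightarrow> 'b::euclidean_space"
  assumes [measurable]: "f \<in> borel_measurable M" "g \<in> borel_measurable M"
    and i: "integrable M (\<lambda>x. (norm (f x))\<^sup>2)" "integrable M (\<lambda>x. (norm (g x))\<^sup>2)"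
  shows "integrable M (\<lambda>x. (norm (f x - c *\<^sub>R g x))\<^sup>2)"
    and "(\<integral>x. (norm (f x - c *\<^sub>R g x))\<^sup>2 \<partial>M)
       = (\<integral>x. (norm (f x))\<^sup>2 \<partial>M) - 2 * c * (\<integral>x. f x \<bullet> g x \<partial>M) + c\<^sup>2 * (\<integral>x. (norm (g x))\<^sup>2 \<partial>M)"
proof -
  note fg = square_integrable_inner[OF assms]
  have eq: "(norm (f x - c *\<^sub>R g x))\<^sup>2 = (norm (f x))\<^sup>2 - 2 * c * (f x \<bullet> g x) + c\<^sup>2 * (norm (g x))\<^sup>2" for x
    unfolding power2_norm_eq_inner by (simp add: inner_diff inner_commute algebra_simps power2_eq_square)
  show "integrable M (\<lambda>x. (norm (f x - c *\<^sub>R g x))\<^sup>2)"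
    unfolding eq using i fg by simp
  show "(\<integral>x. (norm (f x - c *\<^sub>R g x))\<^sup>2 \<partial>M)
       = (\<integral>x. (norm (f x))\<^sup>2 \<partial>M) - 2 * c * (\<integral>x. f x \<bullet> g x \<partial>M) + c\<^sup>2 * (\<integral>x. (norm (g x))\<^sup>2 \<partial>M)"
    unfolding eq using i fg by simp
qed

lemma Cauchy_Schwarz_integral_inner:
  fixes f g :: "'a \<Rightarrow> 'b::euclidean_space"
  assumes "f \<in> borel_measurable M" "g \<in> borel_measurable M"
    and "integrable M (\<lambda>x. (norm (f x))\<^sup>2)" "integrable M (\<lambda>x. (norm (g x))\<^sup>2)"
  shows "\<bar>\<integral>x. f x \<bullet> g x \<partial>M\<bar> \<le> sqrt (\<integral>x. (norm (f x))\<^sup>2 \<partial>M) * sqrt (\<integral>x. (norm (g x))\<^sup>2 \<partial>M)"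
proof -
  define A B C where "A = (\<integral>x. (norm (f x))\<^sup>2 \<partial>M)" and "B = (\<integral>x. (norm (g x))\<^sup>2 \<partial>M)"
    and "C = (\<integral>x. f x \<bullet> g x \<partial>M)"
  have nonneg: "0 \<le> A - 2 * c * C + c\<^sup>2 * B" for c
    unfolding A_def B_def C_def square_integrable_scaleR_diff(2)[OF assms, symmetric] by simp
  have "B \<ge> 0" by (simp add: B_def)
  have "C\<^sup>2 \<le> A * B"
  proof (cases "B = 0")
    case True
    have "C = 0"
    proof (rule ccontr)
      assume "C \<noteq> 0"
      then show False using nonneg[of "(A + 1) / (2 * C)"] True by (simp add: field_simps)
    qed
    then show ?thesis using True by simp
  next
    case False
    then show ?thesis using nonneg[of "C / B"] \<open>B \<ge> 0\<close>
      by (simp add: field_simps power2_eq_square)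
  qed
  then have "\<bar>C\<bar> \<le> sqrt (A * B)" by (metis real_sqrt_abs real_sqrt_le_mono)
  then show ?thesis by (simp only: real_sqrt_mult A_def B_def C_def)
qed

lemma complete_measure_lebesgue_on:
  assumes "S \<in> sets lebesgue"
  shows "complete_measure (lebesgue_on S)"
proof
  fix A B assume "B \<subseteq> A" "A \<in> null_sets (lebesgue_on S)"
  then have "A \<in> null_sets lebesgue" "A \<subseteq> S"
    using assms by (auto simp: null_sets_restrict_space)
  then have "B \<in> null_sets lebesgue" using \<open>B \<subseteq> A\<close>
    by (meson completion.complete2)
  then show "B \<in> sets (lebesgue_on S)"
    using assms \<open>B \<subseteq> A\<close> \<open>A \<subseteq> S\<close> by (auto simp: sets_restrict_space_iff)
qed

lemma (in complete_measure) borel_measurable_if_AE_eq: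
  fixes f g :: "'a \<Rightarrow> 'b::topological_space"
  assumes f: "f \<in> borel_measurable M" and ae: "AE x in M. f x = g x"
  shows "g \<in> borel_measurable M"
proof -
  obtain N where N: "N \<in> null_sets M" "{x \<in> space M. f x \<noteq> g x} \<subseteq> N"
    using ae by (auto simp: eventually_ae_filter)
  show ?thesis
  proof (rule measurableI)
    fix A :: "'b set" assume "A \<in> sets borel"
    have "g -` A \<inter> space M = ((f -` A \<inter> space M) - N) \<union> (g -` A \<inter> space M \<inter> N)"
      using N(2) by fastforce
    moreover have "g -` A \<inter> space M \<inter> N \<in> sets M"
      using N(1) by (meson complete inf_le2)
    moreover have "f -` A \<inter> space M \<in> sets M" using f \<open>A \<in> sets borel\<close> by measurable
    ultimately show "g -` A \<inter> space M \<in> sets M"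
      using N(1) by (metis null_setsD2 sets.Diff sets.Un)
  qed simp
qed

text \<open>On a complete measure two almost everywhere equal functions are both measurable or both not, and
  in the second case both integrals have the default value \<open>0\<close>. This allows a change of representative
  inside integrals whose integrand, like \<open>\<lambda>t. \<xi> t (\<phi> t)\<close> in the weak equation, is not known to be
  measurable.\<close>

lemma (in complete_measure) integral_cong_AE':
  fixes f g :: "'a \<Rightarrow> 'b::{banach, second_countable_topology}"
  assumes ae: "AE x in M. f x = g x"
  shows "(\<integral>x. f x \<partial>M) = (\<integral>x. g x \<partial>M)"
proof (cases "f \<in> borel_measurable M")
  case True
  then show ?thesis using borel_measurable_if_AE_eq[OF True ae] ae by (intro integral_cong_AE) auto
next
  case False
  have "AE x in M. g x = f x" using ae by auto
  then have "g \<notin> borel_measurable M" using borel_measurable_if_AE_eq False by metis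
  then show ?thesis using False by (metis borel_measurable_integrable not_integrable_integral_eq)
qed

lemma (in complete_measure) borel_measurable_AE_limit:
  fixes f :: "nat \<Rightarrow> 'a \<Rightarrow> real"
  assumes f: "\<And>n. f n \<in> borel_measurable M" and lim: "AE x in M. (\<lambda>n. f n x) \<longlonglongrightarrow> g x"
  shows "g \<in> borel_measurable M"
proof (rule borel_measurable_if_AE_eq)
  show "(\<lambda>x. lim (\<lambda>n. f n x)) \<in> borel_measurable M" using f by measurable
  show "AE x in M. lim (\<lambda>n. f n x) = g x" using lim by eventually_elim (rule limI)
qed


section \<open>The torus as a probability space\<close>

definition cell :: "(real ^ 'n) set" where
  "cell = {x. \<forall>i. 0 \<le> x $ i \<and> x $ i < 1}"

lemma torus_eq: "torus = lebesgue_on cell"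
  by (simp add: torus_def cell_def)

lemma box_subset_cell: "box 0 (1 :: real ^ 'n) \<subseteq> cell"
  by (auto simp: cell_def mem_box_cart intro: less_imp_le)

lemma cell_subset_cbox: "cell \<subseteq> cbox 0 (1 :: real ^ 'n)"
  unfolding cell_def by (auto simp: mem_box_cart) (meson less_imp_le)

lemma One_cart: "(One :: real ^ 'n) = 1"
proof (rule euclidean_eqI)
  fix b :: "real ^ 'n" assume b: "b \<in> Basis"
  then obtain i where "b = axis i 1" by (auto simp: Basis_vec_def)
  then have "1 \<bullet> b = 1" by (simp add: inner_axis)
  moreover have "One \<bullet> b = 1" using b by simp
  ultimately show "One \<bullet> b = 1 \<bullet> b" by simp
qed

lemma cell_diff_null: "cell - box 0 (1 :: real ^ 'n) \<in> null_sets lebesgue"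
proof -
  have "negligible (cbox 0 1 - box 0 (1 :: real ^ 'n))" by (rule negligible_frontier_interval)
  then show ?thesis unfolding negligible_iff_null_sets[symmetric]
    by (rule negligible_subset) (use cell_subset_cbox in auto)
qed

lemma cell_sets [measurable, simp]: "(cell :: (real ^ 'n) set) \<in> sets lebesgue"
proof -
  have "(cell :: (real ^ 'n) set) = box 0 1 \<union> (cell - box 0 1)" using box_subset_cell by auto
  then show ?thesis using cell_diff_null
    by (metis (no_types, lifting) lmeasurable_box fmeasurableD null_setsD2 sets.Un)
qed

lemma space_torus [simp]: "space torus = cell"
  by (simp add: torus_eq)

lemma AE_torus_interior: "AE x in torus. \<forall>i. 0 < x $ i \<and> x $ i < (1 :: real)"
proof -
  have "AE x in lebesgue. x \<notin> cell - box 0 (1 :: real ^ 'n)"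
    by (rule AE_not_in[OF cell_diff_null])
  then have "AE x in lebesgue. x \<in> cell \<longrightarrow> (\<forall>i. 0 < x $ i \<and> x $ i < (1 :: real))"
    by eventually_elim (auto simp: mem_box_cart)
  then show ?thesis unfolding torus_eq by (subst AE_restrict_space_iff) auto
qed

lemma emeasure_torus: "emeasure torus (cell :: (real ^ 'n) set) = 1"
proof -
  have "emeasure torus (cell :: (real ^ 'n) set) = emeasure lebesgue (cell :: (real ^ 'n) set)"
    by (simp add: torus_eq emeasure_restrict_space)
  also have "\<dots> = emeasure lebesgue (box 0 1 \<union> (cell - box 0 (1 :: real ^ 'n)))"
    using box_subset_cell by (metis Un_Diff_cancel sup.absorb2)
  also have "\<dots> = emeasure lebesgue (box 0 (1 :: real ^ 'n))"
    by (rule emeasure_Un_null_set) (use cell_diff_null in auto)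
  also have "\<dots> = 1"
    using emeasure_lborel_box[of "0 :: real ^ 'n" One] by (simp add: One_cart[symmetric])
  finally show ?thesis .
qed

lemma finite_measure_torus: "finite_measure torus"
  by (rule finite_measureI) (simp add: emeasure_torus)

interpretation torus: finite_measure torus
  by (rule finite_measure_torus)

interpretation torus: complete_measure torus
  unfolding torus_eq by (rule complete_measure_lebesgue_on) simp

lemma measure_torus [simp]: "measure torus cell = 1"
  by (simp add: measure_def emeasure_torus)

lemma torus_mean_eq: "torus_mean f = (\<integral>x. f x \<partial>torus)"
  by (simp add: torus_mean_def)

lemma L2_measurable: "f \<in> L2 \<Longrightarrow> f \<in> borel_measurable torus"
  by (simp add: L2_def)

lemma L2_square_integrable: "f \<in> L2 \<Longrightarrow> integrable torus (\<lambda>x. (norm (f x))\<^sup>2)"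
  by (simp add: L2_def)

lemma L2_inner_integrable: "f \<in> L2 \<Longrightarrow> g \<in> L2 \<Longrightarrow> integrable torus (\<lambda>x. f x \<bullet> g x)"
  unfolding L2_def by (blast intro: square_integrable_inner)

lemma norm_L2_nonneg [simp]: "0 \<le> norm_L2 f"
  by (simp add: norm_L2_def)

lemma norm_L2_square: "(norm_L2 f)\<^sup>2 = (\<integral>x. (norm (f x))\<^sup>2 \<partial>torus)"
  by (simp add: norm_L2_def)

lemma L2_Cauchy_Schwarz:
  "f \<in> L2 \<Longrightarrow> g \<in> L2 \<Longrightarrow> \<bar>\<integral>x. f x \<bullet> g x \<partial>torus\<bar> \<le> norm_L2 f * norm_L2 g"
  unfolding L2_def norm_L2_def by (blast intro: Cauchy_Schwarz_integral_inner)

lemma L2_diff_scaleR: "f \<in> L2 \<Longrightarrow> g \<in> L2 \<Longrightarrow> (\<lambda>x. f x - c *\<^sub>R g x) \<in> L2"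
  unfolding L2_def by (auto intro: square_integrable_scaleR_diff)

lemma L2_zero: "(\<lambda>x. 0) \<in> L2"
  by (simp add: L2_def)

lemma L2_scaleR: "g \<in> L2 \<Longrightarrow> (\<lambda>x. c *\<^sub>R g x) \<in> L2"
  using L2_diff_scaleR[OF L2_zero, of g "-c"] by simp

lemma L2_diff: "f \<in> L2 \<Longrightarrow> g \<in> L2 \<Longrightarrow> (\<lambda>x. f x - g x) \<in> L2"
  using L2_diff_scaleR[of f g 1] by simp

lemma L2_const: "(\<lambda>x. c) \<in> L2"
  by (simp add: L2_def)

lemma L2_bounded:
  assumes "f \<in> borel_measurable torus" "\<And>x. x \<in> cell \<Longrightarrow> norm (f x) \<le> B"
  shows "f \<in> L2"
proof -
  have [measurable]: "f \<in> borel_measurable torus" by fact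
  have "integrable torus (\<lambda>x. (norm (f x))\<^sup>2)"
    by (rule torus.integrable_const_bound[where B = "B\<^sup>2"])
       (auto intro!: AE_I2 power_mono assms(2))
  then show ?thesis by (simp add: L2_def)
qed

lemma L2_integrable: "f \<in> L2 \<Longrightarrow> integrable torus (f :: real ^ 'n \<Rightarrow> real)"
  using L2_inner_integrable[OF _ L2_const[of 1], of f] by simp


section \<open>Fourier series on the torus\<close>

definition freq :: "int ^ 'n \<Rightarrow> real ^ 'n" where
  "freq k = (\<chi> i. 2 * pi * of_int (k $ i))"

definition character :: "int ^ 'n \<Rightarrow> real ^ 'n \<Rightarrow> complex" where
  "character k x = cis (freq k \<bullet> x)"

definition fourier :: "(real ^ 'n \<Rightarrow> real) \<Rightarrow> int ^ 'n \<Rightarrow> complex" where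
  "fourier f k = (\<integral>x. of_real (f x) * cnj (character k x) \<partial>torus)"

lemma freq_0 [simp]: "freq 0 = 0"
  by (simp add: freq_def vec_eq_iff)

lemma freq_add: "freq (k + l) = freq k + freq l"
  by (simp add: freq_def vec_eq_iff algebra_simps)

lemma freq_minus: "freq (- k) = - freq k"
  by (simp add: freq_def vec_eq_iff)

lemma character_0 [simp]: "character 0 x = 1"
  by (simp add: character_def)

lemma character_add: "character (k + l) x = character k x * character l x"
  by (simp add: character_def freq_add inner_add_left cis_mult)

lemma character_minus: "character (- k) x = cnj (character k x)"
  by (simp add: character_def freq_minus cis_cnj)

lemma character_diff: "character (k - l) x = character k x * cnj (character l x)"
  using character_add[of k "- l" x] by (simp add: character_minus)

lemma norm_character [simp]: "cmod (character k x) = 1"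
  by (simp add: character_def)

lemma continuous_character: "continuous_on UNIV (character k)"
  unfolding character_def cis_conv_exp by (intro continuous_intros)

lemma borel_imp_torus_measurable:
  "f \<in> borel_measurable borel \<Longrightarrow> f \<in> borel_measurable torus"
  unfolding torus_eq by (auto intro!: measurable_restrict_space1 measurable_completion simp: measurable_lborel1)

lemma continuous_imp_torus_measurable:
  "continuous_on UNIV f \<Longrightarrow> f \<in> borel_measurable torus"
  by (intro borel_imp_torus_measurable borel_measurable_continuous_onI)

lemma character_measurable [measurable]: "character k \<in> borel_measurable torus"
  by (rule continuous_imp_torus_measurable[OF continuous_character])

lemma character_integrable: "integrable torus (character k)"
  by (rule torus.integrable_const_bound[where B = 1]) auto

lemma fourier_integrable:
  assumes "f \<in> L2"
  shows "integrable torus (\<lambda>x. of_real (f x) * cnj (character k x))"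
proof (rule Bochner_Integration.integrable_bound)
  show "integrable torus f" by (rule L2_integrable[OF assms])
  have [measurable]: "f \<in> borel_measurable torus" by (rule L2_measurable[OF assms])
  show "(\<lambda>x. of_real (f x) * cnj (character k x)) \<in> borel_measurable torus"
    unfolding character_minus[symmetric] by measurable
qed (simp add: norm_mult)

lemma integral_open_unit_interval_FTC:
  fixes F :: "real \<Rightarrow> 'b::euclidean_space"
  assumes F: "\<And>t. (F has_vector_derivative f t) (at t)" and f: "continuous_on UNIV f"
  shows "(\<integral>t. indicator {0<..<1} t *\<^sub>R f t \<partial>lborel) = F 1 - F 0"
proof -
  have [measurable]: "f \<in> borel_measurable borel"
    by (rule borel_measurable_continuous_onI[OF f])
  have "(\<integral>t. indicator {0<..<1} t *\<^sub>R f t \<partial>lborel) = (\<integral>t. indicator {0..1} t *\<^sub>R f t \<partial>lborel)"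
  proof (rule integral_cong_AE)
    show "AE t in lborel. indicator {0<..<1} t *\<^sub>R f t = indicator {0..1} t *\<^sub>R f t"
      using AE_lborel_singleton[of "0 :: real"] AE_lborel_singleton[of "1 :: real"]
      by eventually_elim (auto simp: indicator_def)
  qed measurable
  also have "\<dots> = F 1 - F 0"
    by (intro has_bochner_integral_integral_eq has_bochner_integral_FTC_Icc)
       (auto intro: has_vector_derivative_at_within F continuous_on_subset[OF f])
  finally show ?thesis .
qed

lemma integral_torus_eq_lborel:
  fixes f :: "real ^ 'n \<Rightarrow> 'b::{banach, second_countable_topology}"
  assumes f: "continuous_on UNIV f"
  shows "(\<integral>x. f x \<partial>torus) = (\<integral>x. indicator (box 0 1) x *\<^sub>R f x \<partial>lborel)"
proof -
  have "(\<integral>x. f x \<partial>torus) = (\<integral>x. indicator (box 0 1) x *\<^sub>R f x \<partial>torus)"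
  proof (rule torus.integral_cong_AE')
    show "AE x in torus. f x = indicator (box 0 1) x *\<^sub>R f x"
      using AE_torus_interior by eventually_elim (simp add: mem_box_cart)
  qed
  also have "\<dots> = (\<integral>x. indicator cell x *\<^sub>R (indicator (box 0 1) x *\<^sub>R f x) \<partial>lebesgue)"
    unfolding torus_eq by (subst integral_restrict_space) auto
  also have "\<dots> = (\<integral>x. indicator (box 0 1) x *\<^sub>R f x \<partial>lebesgue)"
    by (rule Bochner_Integration.integral_cong) (use box_subset_cell in \<open>auto simp: indicator_def\<close>)
  also have "\<dots> = (\<integral>x. indicator (box 0 1) x *\<^sub>R f x \<partial>lborel)"
    by (rule integral_completion)
       (use borel_measurable_continuous_onI[OF f] in \<open>auto intro!: borel_measurable_scaleR borel_measurable_indicator\<close>)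
  finally show ?thesis .
qed

text \<open>The divergence theorem on the torus: by Fubini one integrates first in the direction of \<open>axis i 1\<close>,
  where the fundamental theorem of calculus leaves a difference of \<open>\<eta>\<close> over one period.\<close>

lemma integral_periodic_derivative:
  fixes \<eta> :: "real ^ 'n \<Rightarrow> 'b::euclidean_space"
  assumes deriv: "\<And>x. (\<eta> has_derivative \<eta>' x) (at x)"
    and cont: "continuous_on UNIV (\<lambda>x. \<eta>' x (axis i 1))"
    and periodic: "\<And>x. \<eta> (x + axis i 1) = \<eta> x"
  shows "(\<integral>x. \<eta>' x (axis i 1) \<partial>torus) = 0"
proof -
  let ?B = "Basis :: (real ^ 'n) set"
  define b0 :: "real ^ 'n" where "b0 = axis i 1"
  define I where "I = ?B - {b0}"
  have b0: "b0 \<in> ?B" by (auto simp: b0_def axis_in_Basis_iff)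
  have I: "finite I" "b0 \<notin> I" "insert b0 I = ?B" using b0 by (auto simp: I_def)
  define F where "F z = indicator (box 0 1) z *\<^sub>R \<eta>' z b0" for z
  define S where "S x = (\<Sum>b\<in>?B. x b *\<^sub>R b)" for x :: "real ^ 'n \<Rightarrow> real"
  have cont': "continuous_on UNIV (\<lambda>z. \<eta>' z b0)" using cont by (simp add: b0_def)
  have F_meas [measurable]: "F \<in> borel_measurable borel"
    unfolding F_def using borel_measurable_continuous_onI[OF cont']
    by (auto intro!: borel_measurable_scaleR borel_measurable_indicator)
  have S_meas [measurable]: "S \<in> (\<Pi>\<^sub>M b\<in>?B. lborel) \<rightarrow>\<^sub>M borel"
    unfolding S_def by measurable
  have F_int: "integrable lborel F"
  proof -
    have "compact (cbox 0 (1 :: real ^ 'n))" by simp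
    then have "bounded ((\<lambda>z. \<eta>' z b0) ` cbox 0 1)"
      by (intro compact_imp_bounded compact_continuous_image continuous_on_subset[OF cont']) auto
    then obtain C where C: "\<And>z. z \<in> cbox 0 1 \<Longrightarrow> norm (\<eta>' z b0) \<le> C"
      by (auto simp: bounded_iff)
    show ?thesis
      unfolding F_def
    proof (rule integrableI_bounded_set_indicator[where B = C])
      show "(\<lambda>z. \<eta>' z b0) \<in> borel_measurable lborel"
        using borel_measurable_continuous_onI[OF cont'] by simp
      show "AE x in lborel. x \<in> box 0 1 \<longrightarrow> norm (\<eta>' x b0) \<le> C"
        using C box_subset_cbox by (intro AE_I2) blast
      show "emeasure lborel (box 0 (1 :: real ^ 'n)) < \<infinity>"
        by (simp add: One_cart[symmetric] emeasure_lborel_box_eq)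
    qed simp
  qed
  interpret product_sigma_finite "\<lambda>_ :: real ^ 'n. lborel :: real measure" ..
  have FS_int: "integrable (\<Pi>\<^sub>M b\<in>?B. lborel) (\<lambda>x. F (S x))"
    using F_int by (subst (asm) lborel_eq, subst (asm) integrable_distr_eq) (auto simp: S_def)
  have "(\<integral>x. \<eta>' x (axis i 1) \<partial>torus) = (\<integral>z. F z \<partial>lborel)"
    using integral_torus_eq_lborel[OF cont'] by (simp add: F_def b0_def)
  also have "\<dots> = (\<integral>x. F (S x) \<partial>(\<Pi>\<^sub>M b\<in>?B. lborel))"
    by (subst lborel_eq, subst integral_distr) (auto simp: S_def)
  also have "\<dots> = (\<integral>x. (\<integral>y. F (S (x(b0 := y))) \<partial>lborel) \<partial>(\<Pi>\<^sub>M b\<in>I. lborel))"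
    using product_integral_insert[OF I(1,2), of "\<lambda>x. F (S x)"] FS_int I(3) by simp
  also have "\<dots> = (\<integral>x. 0 \<partial>(\<Pi>\<^sub>M b\<in>I. (lborel :: real measure)))"
  proof (rule Bochner_Integration.integral_cong[OF refl])
    fix x :: "real ^ 'n \<Rightarrow> real"
    define z where "z = (\<Sum>b\<in>I. x b *\<^sub>R b)"
    have S: "S (x(b0 := y)) = z + y *\<^sub>R b0" for y
    proof -
      have "S (x(b0 := y)) = (\<Sum>b\<in>insert b0 I. (x(b0 := y)) b *\<^sub>R b)" by (simp add: S_def I(3))
      also have "\<dots> = y *\<^sub>R b0 + (\<Sum>b\<in>I. (x(b0 := y)) b *\<^sub>R b)" using I(1,2) by simp
      also have "(\<Sum>b\<in>I. (x(b0 := y)) b *\<^sub>R b) = z"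
        unfolding z_def by (rule sum.cong) (use I(2) in auto)
      finally show ?thesis by (simp only: add.commute)
    qed
    have coord: "S w \<bullet> b = w b" if "b \<in> ?B" for w b
      using that by (simp add: S_def)
    \<comment> \<open>\<open>c\<close> is the indicator of the cell in the remaining coordinates.\<close>
    define c :: real where "c = (if \<forall>b\<in>I. 0 < x b \<and> x b < 1 then 1 else 0)"
    have ind: "indicator (box 0 1) (S (x(b0 := y))) = c * indicator {0<..<1} y" for y
    proof -
      have "S (x(b0 := y)) \<in> box 0 1 \<longleftrightarrow> (\<forall>b\<in>insert b0 I. 0 < (x(b0 := y)) b \<and> (x(b0 := y)) b < 1)"
        unfolding One_cart[symmetric] mem_box by (simp add: coord I(3))
      also have "\<dots> \<longleftrightarrow> (0 < y \<and> y < 1) \<and> (\<forall>b\<in>I. 0 < x b \<and> x b < 1)"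
        using I(2) by auto
      finally show ?thesis by (simp add: c_def indicator_def)
    qed
    have "(\<integral>y. F (S (x(b0 := y))) \<partial>lborel) = (\<integral>y. c *\<^sub>R (indicator {0<..<1} y *\<^sub>R \<eta>' (z + y *\<^sub>R b0) b0) \<partial>lborel)"
      by (simp only: F_def ind[unfolded S] S scaleR_scaleR)
    also have "\<dots> = c *\<^sub>R (\<integral>y. indicator {0<..<1} y *\<^sub>R \<eta>' (z + y *\<^sub>R b0) b0 \<partial>lborel)"
      by (rule integral_scaleR_right)
    also have "(\<integral>y. indicator {0<..<1} y *\<^sub>R \<eta>' (z + y *\<^sub>R b0) b0 \<partial>lborel) = \<eta> (z + 1 *\<^sub>R b0) - \<eta> (z + 0 *\<^sub>R b0)"
    proof (rule integral_open_unit_interval_FTC)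
      show "((\<lambda>y. \<eta> (z + y *\<^sub>R b0)) has_vector_derivative \<eta>' (z + t *\<^sub>R b0) b0) (at t)" for t
      proof -
        have "((\<lambda>y. z + y *\<^sub>R b0) has_derivative (\<lambda>h. h *\<^sub>R b0)) (at t)"
          by (auto intro!: derivative_eq_intros)
        from has_derivative_compose[OF this deriv]
        show ?thesis unfolding has_vector_derivative_def
          by (simp add: linear_scale[OF has_derivative_linear[OF deriv]])
      qed
      show "continuous_on UNIV (\<lambda>y. \<eta>' (z + y *\<^sub>R b0) b0)"
        by (rule continuous_on_compose2[OF cont']) (auto intro!: continuous_intros)
    qed
    also have "\<dots> = 0" using periodic[of z] by (simp add: b0_def)
    finally show "(\<integral>y. F (S (x(b0 := y))) \<partial>lborel) = 0" by (simp only: scaleR_zero_right)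
  qed
  finally show ?thesis by simp
qed

text \<open>A nonconstant character is, up to a nonzero factor, its own partial derivative, so that its integral
  vanishes.\<close>

lemma integral_character:
  fixes k :: "int ^ 'n"
  shows "(\<integral>x. character k x \<partial>torus) = (if k = 0 then 1 else 0)"
proof (cases "k = 0")
  case True
  then show ?thesis by simp
next
  case False
  then obtain j where j: "k $ j \<noteq> 0" by (auto simp: vec_eq_iff)
  have "(\<integral>x. \<i> * of_real (freq k \<bullet> axis j 1) * character k x \<partial>torus) = 0"
  proof (rule integral_periodic_derivative)
    show "(character k has_derivative (\<lambda>v. \<i> * of_real (freq k \<bullet> v) * character k x)) (at x)" for x
    proof -
      have "((\<lambda>x. \<i> * of_real (freq k \<bullet> x)) has_derivative (\<lambda>v. \<i> * of_real (freq k \<bullet> v))) (at x)"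
        by (auto intro!: derivative_eq_intros)
      from has_derivative_compose[OF this DERIV_exp[THEN has_field_derivative_imp_has_derivative]]
      show ?thesis by (simp add: character_def[abs_def] cis_conv_exp mult.commute)
    qed
    show "continuous_on UNIV (\<lambda>x. \<i> * of_real (freq k \<bullet> axis j 1) * character k x)"
      by (intro continuous_intros continuous_character)
    show "character k (x + axis j 1) = character k x" for x
      using cis_multiple_2pi[of "of_int (k $ j)"]
      by (simp add: character_def inner_add_right inner_axis cis_mult[symmetric] freq_def)
  qed
  then show ?thesis using j False by (simp add: inner_axis freq_def)
qed

text \<open>By orthonormality of the characters. The choice \<open>c = fourier f\<close> gives Bessel's inequality; a choice
  that makes the left-hand side small shows that the Fourier coefficients exhaust the norm of \<open>f\<close>.\<close>

lemma norm_diff_trig_sum: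
  fixes f :: "real ^ 'n \<Rightarrow> real"
  assumes f: "f \<in> L2" and F: "finite F"
  shows "integrable torus (\<lambda>x. (cmod (of_real (f x) - (\<Sum>k\<in>F. c k * character k x)))\<^sup>2)"
    and "(\<integral>x. (cmod (of_real (f x) - (\<Sum>k\<in>F. c k * character k x)))\<^sup>2 \<partial>torus)
       = (norm_L2 f)\<^sup>2 - (\<Sum>k\<in>F. (cmod (fourier f k))\<^sup>2) + (\<Sum>k\<in>F. (cmod (c k - fourier f k))\<^sup>2)"
proof -
  define P where "P x = (\<Sum>k\<in>F. c k * character k x)" for x
  note fi = fourier_integrable[OF f]
  have eq: "of_real ((cmod (of_real (f x) - P x))\<^sup>2) =
      of_real ((f x)\<^sup>2) - (\<Sum>k\<in>F. cnj (c k) * (of_real (f x) * cnj (character k x)))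
        - (\<Sum>k\<in>F. c k * cnj (of_real (f x) * cnj (character k x)))
        + (\<Sum>k\<in>F. \<Sum>l\<in>F. c k * cnj (c l) * character (k - l) x)" for x
  proof -
    have "of_real ((cmod (of_real (f x) - P x))\<^sup>2) = (of_real (f x) - P x) * cnj (of_real (f x) - P x)"
      by (rule complex_norm_square)
    also have "\<dots> = of_real ((f x)\<^sup>2) - of_real (f x) * cnj (P x) - P x * of_real (f x) + P x * cnj (P x)"
      by (simp add: algebra_simps power2_eq_square)
    also have "of_real (f x) * cnj (P x) = (\<Sum>k\<in>F. cnj (c k) * (of_real (f x) * cnj (character k x)))"
      by (simp add: P_def sum_distrib_left algebra_simps)
    also have "P x * of_real (f x) = (\<Sum>k\<in>F. c k * cnj (of_real (f x) * cnj (character k x)))"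
      by (simp add: P_def sum_distrib_left sum_distrib_right algebra_simps)
    also have "P x * cnj (P x) = (\<Sum>k\<in>F. \<Sum>l\<in>F. c k * cnj (c l) * character (k - l) x)"
      by (simp add: P_def sum_product character_diff algebra_simps)
    finally show ?thesis .
  qed
  have fsq: "integrable torus (\<lambda>x. (f x)\<^sup>2)"
    using L2_square_integrable[OF f] unfolding real_norm_def power2_abs .
  have fi': "integrable torus (\<lambda>x. cnj (of_real (f x) * cnj (character k x)))" for k
    by (rule integrable_cnj[OF fi])
  have i0: "integrable torus (\<lambda>x. of_real ((f x)\<^sup>2) :: complex)"
    using fsq by (rule integrable_of_real)
  have i1: "integrable torus (\<lambda>x. \<Sum>k\<in>F. cnj (c k) * (of_real (f x) * cnj (character k x)))"
    by (intro Bochner_Integration.integrable_sum integrable_mult_right fi)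
  have i2: "integrable torus (\<lambda>x. \<Sum>k\<in>F. c k * cnj (of_real (f x) * cnj (character k x)))"
    by (intro Bochner_Integration.integrable_sum integrable_mult_right fi')
  have i3: "integrable torus (\<lambda>x. \<Sum>k\<in>F. \<Sum>l\<in>F. c k * cnj (c l) * character (k - l) x)"
    by (intro Bochner_Integration.integrable_sum integrable_mult_right character_integrable)
  have v0: "(\<integral>x. of_real ((f x)\<^sup>2) \<partial>torus) = complex_of_real (\<integral>x. (f x)\<^sup>2 \<partial>torus)"
    by (rule integral_complex_of_real)
  have v1: "(\<integral>x. (\<Sum>k\<in>F. cnj (c k) * (of_real (f x) * cnj (character k x))) \<partial>torus)
      = (\<Sum>k\<in>F. cnj (c k) * fourier f k)"
    unfolding fourier_def
    by (simp only: Bochner_Integration.integral_sum integrable_mult_right fi integral_mult_right_zero)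
  have v2: "(\<integral>x. (\<Sum>k\<in>F. c k * cnj (of_real (f x) * cnj (character k x))) \<partial>torus)
      = (\<Sum>k\<in>F. c k * cnj (fourier f k))"
    unfolding fourier_def Bochner_Integration.integral_cnj[symmetric]
    by (simp only: Bochner_Integration.integral_sum integrable_mult_right fi' integral_mult_right_zero)
  have v3: "(\<integral>x. (\<Sum>k\<in>F. \<Sum>l\<in>F. c k * cnj (c l) * character (k - l) x) \<partial>torus)
      = (\<Sum>k\<in>F. \<Sum>l\<in>F. c k * cnj (c l) * (if k - l = 0 then 1 else 0))"
    unfolding integral_character[symmetric]
    by (simp only: Bochner_Integration.integral_sum Bochner_Integration.integrable_sum
        integrable_mult_right character_integrable integral_mult_right_zero)
  have int: "integrable torus (\<lambda>x. of_real ((cmod (of_real (f x) - P x))\<^sup>2) :: complex)"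
    unfolding eq
    by (intro Bochner_Integration.integrable_add Bochner_Integration.integrable_diff i0 i1 i2 i3)
  show "integrable torus (\<lambda>x. (cmod (of_real (f x) - (\<Sum>k\<in>F. c k * character k x)))\<^sup>2)"
    using integrable_Re[OF int] unfolding Re_complex_of_real P_def .
  have "of_real (\<integral>x. (cmod (of_real (f x) - P x))\<^sup>2 \<partial>torus)
      = (\<integral>x. of_real ((cmod (of_real (f x) - P x))\<^sup>2) \<partial>torus :: complex)"
    by (rule integral_complex_of_real[symmetric])
  also have "\<dots> = of_real (\<integral>x. (f x)\<^sup>2 \<partial>torus) - (\<Sum>k\<in>F. cnj (c k) * fourier f k)
        - (\<Sum>k\<in>F. c k * cnj (fourier f k))
        + (\<Sum>k\<in>F. \<Sum>l\<in>F. c k * cnj (c l) * (if k - l = 0 then 1 else 0))"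
    unfolding eq using i0 i1 i2 i3 by (simp only: Bochner_Integration.integral_add
        Bochner_Integration.integral_diff Bochner_Integration.integrable_diff v0 v1 v2 v3)
  also have "(\<Sum>k\<in>F. \<Sum>l\<in>F. c k * cnj (c l) * (if k - l = 0 then 1 else 0)) = (\<Sum>k\<in>F. c k * cnj (c k))"
    by (rule sum.cong) (use F in \<open>auto simp: if_distrib cong: if_cong\<close>)
  also have "of_real (\<integral>x. (f x)\<^sup>2 \<partial>torus) - (\<Sum>k\<in>F. cnj (c k) * fourier f k)
        - (\<Sum>k\<in>F. c k * cnj (fourier f k)) + (\<Sum>k\<in>F. c k * cnj (c k))
      = of_real (\<integral>x. (f x)\<^sup>2 \<partial>torus) - (\<Sum>k\<in>F. fourier f k * cnj (fourier f k))
        + (\<Sum>k\<in>F. (c k - fourier f k) * cnj (c k - fourier f k))"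
    by (simp add: sum.distrib[symmetric] sum_subtractf[symmetric] algebra_simps)
  also have "\<dots> = of_real ((norm_L2 f)\<^sup>2 - (\<Sum>k\<in>F. (cmod (fourier f k))\<^sup>2) + (\<Sum>k\<in>F. (cmod (c k - fourier f k))\<^sup>2))"
    unfolding complex_norm_square[symmetric] by (simp add: norm_L2_square)
  finally show "(\<integral>x. (cmod (of_real (f x) - (\<Sum>k\<in>F. c k * character k x)))\<^sup>2 \<partial>torus)
       = (norm_L2 f)\<^sup>2 - (\<Sum>k\<in>F. (cmod (fourier f k))\<^sup>2) + (\<Sum>k\<in>F. (cmod (c k - fourier f k))\<^sup>2)"
    unfolding P_def of_real_eq_iff .
qed

lemma Bessel_inequality:
  assumes "f \<in> L2" "finite F"
  shows "(\<Sum>k\<in>F. (cmod (fourier f k))\<^sup>2) \<le> (norm_L2 f)\<^sup>2"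
proof -
  have "0 \<le> (\<integral>x. (cmod (of_real (f x) - (\<Sum>k\<in>F. fourier f k * character k x)))\<^sup>2 \<partial>torus)" by simp
  then show ?thesis unfolding norm_diff_trig_sum(2)[OF assms] by simp
qed

definition trig_poly :: "(real ^ 'n \<Rightarrow> complex) \<Rightarrow> bool" where
  "trig_poly P \<longleftrightarrow> (\<exists>F c. finite F \<and> P = (\<lambda>x. \<Sum>k\<in>F. c k * character k x))"

lemma trig_poly_character: "trig_poly (\<lambda>x. c * character k x)"
  unfolding trig_poly_def by (rule exI[of _ "{k}"], rule exI[of _ "\<lambda>_. c"]) simp

lemma trig_poly_const: "trig_poly (\<lambda>x. c)"
  using trig_poly_character[of c 0] by simp

lemma trig_poly_add:
  assumes "trig_poly P" "trig_poly Q"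
  shows "trig_poly (\<lambda>x. P x + Q x)"
proof -
  obtain F c G d where F: "finite F" "P = (\<lambda>x. \<Sum>k\<in>F. c k * character k x)"
    and G: "finite G" "Q = (\<lambda>x. \<Sum>k\<in>G. d k * character k x)"
    using assms unfolding trig_poly_def by blast
  let ?c = "\<lambda>k. (if k \<in> F then c k else 0) + (if k \<in> G then d k else 0)"
  have "P x + Q x = (\<Sum>k\<in>F \<union> G. ?c k * character k x)" for x
  proof -
    have "P x = (\<Sum>k\<in>F \<union> G. (if k \<in> F then c k else 0) * character k x)"
      unfolding F(2) by (rule sum.mono_neutral_cong_left) (use F G in auto)
    moreover have "Q x = (\<Sum>k\<in>F \<union> G. (if k \<in> G then d k else 0) * character k x)"
      unfolding G(2) by (rule sum.mono_neutral_cong_left) (use F G in auto)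
    ultimately show ?thesis by (simp add: distrib_right sum.distrib)
  qed
  then show ?thesis unfolding trig_poly_def using F(1) G(1)
    by (intro exI[of _ "F \<union> G"] exI[of _ ?c]) auto
qed

lemma trig_poly_sum:
  "finite I \<Longrightarrow> (\<And>i. i \<in> I \<Longrightarrow> trig_poly (P i)) \<Longrightarrow> trig_poly (\<lambda>x. \<Sum>i\<in>I. P i x)"
  by (induction I rule: finite_induct) (auto intro: trig_poly_add trig_poly_const)

lemma trig_poly_mult:
  assumes "trig_poly P" "trig_poly Q"
  shows "trig_poly (\<lambda>x. P x * Q x)"
proof -
  obtain F c G d where F: "finite F" "P = (\<lambda>x. \<Sum>k\<in>F. c k * character k x)"
    and G: "finite G" "Q = (\<lambda>x. \<Sum>k\<in>G. d k * character k x)"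
    using assms unfolding trig_poly_def by blast
  have "(\<lambda>x. P x * Q x) = (\<lambda>x. \<Sum>k\<in>F. \<Sum>l\<in>G. (c k * d l) * character (k + l) x)"
    by (simp add: F G sum_product character_add algebra_simps)
  then show ?thesis using F(1) G(1) by (auto intro!: trig_poly_sum trig_poly_character)
qed

text \<open>The torus as a compact set in a Euclidean space. Polynomials in the coordinates of this embedding
  are trigonometric polynomials, which makes the Stone-Weierstrass theorem available.\<close>

definition circle_embedding :: "real ^ 'n \<Rightarrow> complex ^ 'n" where
  "circle_embedding x = (\<chi> i. cis (2 * pi * x $ i))"

lemma character_axis: "character (axis i 1) x = cis (2 * pi * x $ i)"
proof -
  have "freq (axis i 1) = axis i (2 * pi)" by (simp add: freq_def axis_def vec_eq_iff)
  then show ?thesis by (simp add: character_def inner_axis')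
qed

text \<open>Trigonometric polynomials form an algebra, so that only linear functions remain, and every real
  coordinate of the embedding is a combination of a character and its conjugate.\<close>

lemma trig_poly_real_polynomial:
  assumes "real_polynomial_function p"
  shows "trig_poly (\<lambda>x :: real ^ 'n. of_real (p (circle_embedding x)))"
  using assms
proof (induction p rule: real_polynomial_function.induct)
  case (linear f)
  have f: "f y = (\<Sum>b\<in>Basis. (y \<bullet> b) * f b)" for y :: "complex ^ 'n"
  proof -
    have "f y = f (\<Sum>b\<in>Basis. (y \<bullet> b) *\<^sub>R b)" by (simp add: euclidean_representation)
    also have "\<dots> = (\<Sum>b\<in>Basis. (y \<bullet> b) * f b)"
      using linear by (simp add: linear_sum bounded_linear.linear linear_scale)
    finally show ?thesis .
  qed
  have "trig_poly (\<lambda>x. of_real (circle_embedding x \<bullet> b))" if b: "b \<in> Basis" for b :: "complex ^ 'n"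
  proof -
    obtain i u where b: "b = axis i u" using b by (auto simp: Basis_vec_def)
    have re: "of_real (z \<bullet> u) = cnj u / 2 * z + u / 2 * cnj z" for z
      by (simp add: complex_eq_iff inner_complex_def field_simps)
    have "of_real (circle_embedding x \<bullet> b)
        = cnj u / 2 * character (axis i 1) x + u / 2 * character (- axis i 1) x" for x
      unfolding b inner_axis re by (simp add: circle_embedding_def character_axis character_minus)
    then show ?thesis by (simp only: trig_poly_add trig_poly_character)
  qed
  then have "trig_poly (\<lambda>x. \<Sum>b\<in>Basis. of_real (f b) * of_real (circle_embedding x \<bullet> b))"
    by (intro trig_poly_sum trig_poly_mult trig_poly_const) auto
  then show ?case by (subst f) (simp add: mult.commute)
qed (auto intro: trig_poly_const trig_poly_add trig_poly_mult)


section \<open>Density of trigonometric polynomials\<close>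

lemma circle_embedding_continuous: "continuous_on S circle_embedding"
  unfolding circle_embedding_def cis_conv_exp
  by (intro continuous_on_vec_lambda continuous_intros)

text \<open>A left inverse of the embedding on the cell. It jumps where the angle passes from \<open>2 \<pi>\<close> to \<open>0\<close>.\<close>

lemma Arg2pi_circle_embedding:
  assumes "x \<in> cell"
  shows "Arg2pi (circle_embedding x $ i) / (2 * pi) = x $ i"
proof -
  have "Arg2pi (cis (2 * pi * x $ i)) = 2 * pi * x $ i"
    by (rule Arg2pi_unique[of 1]) (use assms in \<open>auto simp: cell_def cis_conv_exp mult.commute\<close>)
  then show ?thesis by (simp add: circle_embedding_def)
qed

definition approximable :: "(real ^ 'n \<Rightarrow> real) \<Rightarrow> bool" where
  "approximable f \<longleftrightarrow> f \<in> L2 \<and>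
     (\<forall>\<epsilon>>0. \<exists>P. trig_poly P \<and> (\<integral>x. (cmod (of_real (f x) - P x))\<^sup>2 \<partial>torus) < \<epsilon>)"

lemma trig_poly_square_integrable:
  assumes "f \<in> L2" "trig_poly P"
  shows "integrable torus (\<lambda>x. (cmod (of_real (f x) - P x))\<^sup>2)"
  using assms norm_diff_trig_sum(1) unfolding trig_poly_def by blast

lemma approximable_closed:
  assumes f: "f \<in> L2" and g: "\<And>\<epsilon>. \<epsilon> > 0 \<Longrightarrow> \<exists>g. approximable g \<and> (norm_L2 (\<lambda>x. f x - g x))\<^sup>2 < \<epsilon>"
  shows "approximable f"
  unfolding approximable_def
proof (intro conjI f allI impI)
  fix \<epsilon> :: real assume "\<epsilon> > 0"
  then obtain g where g: "approximable g" "(norm_L2 (\<lambda>x. f x - g x))\<^sup>2 < \<epsilon> / 4" using g[of "\<epsilon> / 4"] by auto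
  then obtain P where P: "trig_poly P" "(\<integral>x. (cmod (of_real (g x) - P x))\<^sup>2 \<partial>torus) < \<epsilon> / 4"
    using \<open>\<epsilon> > 0\<close> unfolding approximable_def by (meson divide_pos_pos zero_less_numeral)
  have gL: "g \<in> L2" using g(1) by (simp add: approximable_def)
  have le: "(cmod (of_real (f x) - P x))\<^sup>2 \<le> 2 * (norm (f x - g x))\<^sup>2 + 2 * (cmod (of_real (g x) - P x))\<^sup>2" for x
  proof -
    have "cmod (of_real (f x) - P x) \<le> norm (f x - g x) + cmod (of_real (g x) - P x)"
      using norm_triangle_ineq[of "of_real (f x - g x)" "of_real (g x) - P x"] by (simp del: of_real_diff add: norm_of_real) (simp add: algebra_simps)
    then have "(cmod (of_real (f x) - P x))\<^sup>2 \<le> (norm (f x - g x) + cmod (of_real (g x) - P x))\<^sup>2"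
      by (rule power_mono) simp
    also have "\<dots> \<le> 2 * (norm (f x - g x))\<^sup>2 + 2 * (cmod (of_real (g x) - P x))\<^sup>2"
      using sum_squares_bound[of "norm (f x - g x)" "cmod (of_real (g x) - P x)"] by (simp add: power2_sum)
    finally show ?thesis .
  qed
  have i: "integrable torus (\<lambda>x. (norm (f x - g x))\<^sup>2)"
    by (intro L2_square_integrable L2_diff f gL)
  note i' = trig_poly_square_integrable[OF gL P(1)]
  have "(\<integral>x. (cmod (of_real (f x) - P x))\<^sup>2 \<partial>torus)
      \<le> (\<integral>x. 2 * (norm (f x - g x))\<^sup>2 + 2 * (cmod (of_real (g x) - P x))\<^sup>2 \<partial>torus)"
    by (rule integral_mono[OF trig_poly_square_integrable[OF f P(1)] _ le])
       (use i i' in auto)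
  also have "\<dots> = 2 * (norm_L2 (\<lambda>x. f x - g x))\<^sup>2 + 2 * (\<integral>x. (cmod (of_real (g x) - P x))\<^sup>2 \<partial>torus)"
    using i i' by (simp add: norm_L2_square)
  also have "\<dots> < \<epsilon>" using g(2) P(2) by simp
  finally show "\<exists>P. trig_poly P \<and> (\<integral>x. (cmod (of_real (f x) - P x))\<^sup>2 \<partial>torus) < \<epsilon>"
    using P(1) by blast
qed

text \<open>Dominated convergence turns pointwise limits into limits in \<open>L2\<close>.\<close>

lemma approximable_limit:
  fixes f :: "real ^ 'n \<Rightarrow> real"
  assumes f: "f \<in> L2" and h: "h \<in> L2" and g: "\<And>n. approximable (g n)"
    and lim: "AE x in torus. (\<lambda>n. g n x) \<longlonglongrightarrow> f x"
    and bound: "\<And>n x. x \<in> cell \<Longrightarrow> \<bar>g n x\<bar> \<le> \<bar>h x\<bar>"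
  shows "approximable f"
proof (rule approximable_closed[OF f])
  fix \<epsilon> :: real assume "\<epsilon> > 0"
  have gL: "g n \<in> L2" for n using g by (simp add: approximable_def)
  note [measurable] = L2_measurable[OF f] L2_measurable[OF h] L2_measurable[OF gL]
  have "(\<lambda>n. \<integral>x. (f x - g n x)\<^sup>2 \<partial>torus) \<longlonglongrightarrow> integral\<^sup>L torus (\<lambda>x :: real ^ 'n. 0)"
  proof (rule integral_dominated_convergence)
    show "integrable torus (\<lambda>x. 2 * (norm (f x))\<^sup>2 + 2 * (norm (h x))\<^sup>2)"
      using L2_square_integrable[OF f] L2_square_integrable[OF h] by simp
    show "AE x in torus. (\<lambda>n. (f x - g n x)\<^sup>2) \<longlonglongrightarrow> 0"
      using lim by eventually_elim (auto intro!: tendsto_eq_intros)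
    show "AE x in torus. norm ((f x - g n x)\<^sup>2) \<le> 2 * (norm (f x))\<^sup>2 + 2 * (norm (h x))\<^sup>2" for n
    proof (rule AE_I2)
      fix x :: "real ^ 'n" assume "x \<in> space torus"
      then have "(g n x)\<^sup>2 \<le> (h x)\<^sup>2" using bound[of x n] by (simp add: abs_le_square_iff)
      moreover have "(f x - g n x)\<^sup>2 \<le> 2 * (f x)\<^sup>2 + 2 * (g n x)\<^sup>2"
        using zero_le_power2[of "f x + g n x"] by (simp add: power2_sum power2_diff)
      ultimately show "norm ((f x - g n x)\<^sup>2) \<le> 2 * (norm (f x))\<^sup>2 + 2 * (norm (h x))\<^sup>2" by simp
    qed
  qed measurable
  then have "(\<lambda>n. (norm_L2 (\<lambda>x. f x - g n x))\<^sup>2) \<longlonglongrightarrow> 0" by (simp add: norm_L2_square)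
  then have "\<forall>\<^sub>F n in sequentially. (norm_L2 (\<lambda>x. f x - g n x))\<^sup>2 < \<epsilon>"
    using \<open>\<epsilon> > 0\<close> by (rule order_tendstoD)
  then show "\<exists>g. approximable g \<and> (norm_L2 (\<lambda>x. f x - g x))\<^sup>2 < \<epsilon>"
    using g by (auto simp: eventually_sequentially)
qed

lemma approximable_continuous_on_circles:
  fixes G :: "complex ^ 'n \<Rightarrow> real" and f :: "real ^ 'n \<Rightarrow> real"
  assumes G: "continuous_on (circle_embedding ` cbox 0 1) G"
    and f: "\<And>x. x \<in> cell \<Longrightarrow> f x = G (circle_embedding x)"
  shows "approximable f"
  unfolding approximable_def
proof (intro conjI allI impI)
  let ?K = "circle_embedding ` cbox 0 (1 :: real ^ 'n)"
  have K: "compact ?K"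
    by (intro compact_continuous_image circle_embedding_continuous compact_cbox)
  have "bounded (G ` ?K)"
    using compact_continuous_image[OF G K] by (rule compact_imp_bounded)
  then obtain B where B: "\<And>y. y \<in> ?K \<Longrightarrow> norm (G y) \<le> B" by (auto simp: bounded_iff)
  have "continuous_on (cbox 0 1) (\<lambda>x. G (circle_embedding x))"
    using continuous_on_compose2[OF G circle_embedding_continuous] by auto
  then have "continuous_on cell f"
    using continuous_on_subset[OF _ cell_subset_cbox] f by (simp cong: continuous_on_cong)
  then have "f \<in> borel_measurable torus"
    unfolding torus_eq by (rule continuous_imp_measurable_on_sets_lebesgue) simp
  then show fL: "f \<in> L2"
    by (rule L2_bounded[where B = B]) (use f B cell_subset_cbox in auto)
  fix \<epsilon> :: real assume "\<epsilon> > 0"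
  define \<delta> where "\<delta> = sqrt (\<epsilon> / 2)"
  have \<delta>: "\<delta> > 0" "\<delta>\<^sup>2 < \<epsilon>" using \<open>\<epsilon> > 0\<close> by (auto simp: \<delta>_def)
  obtain p where p: "real_polynomial_function p" "\<And>y. y \<in> ?K \<Longrightarrow> \<bar>G y - p y\<bar> < \<delta>"
    using Stone_Weierstrass_real_polynomial_function[OF K G \<open>\<delta> > 0\<close>] by blast
  define P where "P x = complex_of_real (p (circle_embedding x))" for x
  have P: "trig_poly P" unfolding P_def by (rule trig_poly_real_polynomial[OF p(1)])
  have "(cmod (of_real (f x) - P x))\<^sup>2 \<le> \<delta>\<^sup>2" if "x \<in> cell" for x
  proof -
    have "\<bar>G (circle_embedding x) - p (circle_embedding x)\<bar> \<le> \<delta>"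
      using p(2)[of "circle_embedding x"] that cell_subset_cbox by force
    moreover have "cmod (of_real (f x) - P x) = \<bar>G (circle_embedding x) - p (circle_embedding x)\<bar>"
      unfolding P_def f[OF that] of_real_diff[symmetric] by (rule norm_of_real)
    ultimately show ?thesis by (metis norm_ge_zero power_mono)
  qed
  then have "(\<integral>x. (cmod (of_real (f x) - P x))\<^sup>2 \<partial>torus) \<le> integral\<^sup>L torus (\<lambda>x :: real ^ 'n. \<delta>\<^sup>2)"
    by (intro integral_mono trig_poly_square_integrable fL P) auto
  also have "\<dots> < \<epsilon>" using \<delta> by simp
  finally show "\<exists>P. trig_poly P \<and> (\<integral>x. (cmod (of_real (f x) - P x))\<^sup>2 \<partial>torus) < \<epsilon>"
    using P by blast
qed

text \<open>A continuous function that vanishes precisely where a coordinate of the inverse of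
  \<open>circle_embedding\<close> jumps, and that tends to \<open>1\<close> everywhere else as \<open>n\<close> grows.\<close>

definition cutoff :: "nat \<Rightarrow> complex ^ 'n \<Rightarrow> real" where
  "cutoff n y = (\<Prod>i\<in>UNIV. min 1 (real n * cmod (y $ i - 1)))"

lemma cutoff_bounds: "0 \<le> cutoff n y" "cutoff n y \<le> 1"
  unfolding cutoff_def by (auto intro!: prod_nonneg prod_le_1)

lemma cutoff_continuous: "continuous_on S (cutoff n)"
  unfolding cutoff_def by (intro continuous_intros)

lemma cutoff_eq_0: "y $ i = 1 \<Longrightarrow> cutoff n y = 0"
  unfolding cutoff_def by (rule prod_zero) (auto intro!: exI[of _ i])

lemma cutoff_tendsto:
  assumes "\<And>i. y $ i \<noteq> 1"
  shows "(\<lambda>n. cutoff n y) \<longlonglongrightarrow> 1"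
proof -
  have "(\<lambda>n. min 1 (real n * cmod (y $ i - 1))) \<longlonglongrightarrow> 1" for i
  proof (rule tendsto_eventually)
    have "filterlim (\<lambda>n. real n * cmod (y $ i - 1)) at_top sequentially"
      using assms[of i] by (intro filterlim_at_top_mult_tendsto_pos[OF tendsto_const] filterlim_real_sequentially) auto
    then have "\<forall>\<^sub>F n in sequentially. 1 \<le> real n * cmod (y $ i - 1)"
      by (simp add: filterlim_at_top)
    then show "\<forall>\<^sub>F n in sequentially. min 1 (real n * cmod (y $ i - 1)) = 1"
      by eventually_elim simp
  qed
  then have "(\<lambda>n. cutoff n y) \<longlonglongrightarrow> (\<Prod>i\<in>(UNIV :: 'a set). 1)"
    unfolding cutoff_def by (intro tendsto_prod)
  then show ?thesis by simp
qed

text \<open>The values of \<open>g\<close> at opposite faces of the cell may differ, so \<open>g\<close> itself need not be continuous on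
  the product of circles. After multiplication by the cutoff it is: at a jump the product is at most
  \<open>M\<close> times the cutoff and hence tends to \<open>0\<close>.\<close>

lemma approximable_cutoff_continuous:
  fixes g :: "real ^ 'n \<Rightarrow> real"
  assumes g: "continuous_on UNIV g" and M: "\<And>x. \<bar>g x\<bar> \<le> M"
  shows "approximable (\<lambda>x. g x * cutoff n (circle_embedding x))"
proof (rule approximable_continuous_on_circles)
  define l where "l y = (\<chi> i. Arg2pi (y $ i) / (2 * pi))" for y :: "complex ^ 'n"
  let ?K = "circle_embedding ` cbox 0 (1 :: real ^ 'n)"
  show "g x * cutoff n (circle_embedding x) = g (l (circle_embedding x)) * cutoff n (circle_embedding x)"
    if "x \<in> cell" for x
  proof -
    have "l (circle_embedding x) = x"
      using Arg2pi_circle_embedding[OF that] by (simp add: l_def vec_eq_iff)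
    then show ?thesis by simp
  qed
  show "continuous_on ?K (\<lambda>y. g (l y) * cutoff n y)"
    unfolding continuous_on_def
  proof
    fix y assume y: "y \<in> ?K"
    have cut: "(cutoff n \<longlongrightarrow> cutoff n y) (at y within ?K)"
      using cutoff_continuous y unfolding continuous_on_def by blast
    show "((\<lambda>y. g (l y) * cutoff n y) \<longlongrightarrow> g (l y) * cutoff n y) (at y within ?K)"
    proof (cases "\<exists>i. y $ i = 1")
      case True
      then have 0: "cutoff n y = 0" using cutoff_eq_0 by blast
      have "((\<lambda>y. g (l y) * cutoff n y) \<longlongrightarrow> 0) (at y within ?K)"
      proof (rule Lim_null_comparison)
        show "\<forall>\<^sub>F y in at y within ?K. norm (g (l y) * cutoff n y) \<le> M * cutoff n y"
        proof (intro always_eventually allI)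
          fix y
          show "norm (g (l y) * cutoff n y) \<le> M * cutoff n y"
            using mult_right_mono[OF M cutoff_bounds(1), of "l y" n y] cutoff_bounds(1)[of n y]
            by (simp add: abs_mult)
        qed
        show "((\<lambda>y. M * cutoff n y) \<longlongrightarrow> 0) (at y within ?K)"
          using tendsto_mult_left[OF cut, of M] 0 by simp
      qed
      then show ?thesis by (simp add: 0)
    next
      case False
      have "(Arg2pi \<longlongrightarrow> Arg2pi (y $ i)) (at (y $ i))" for i
      proof -
        have "cmod (y $ i) = 1" using y by (auto simp: circle_embedding_def)
        then have "y $ i \<notin> \<real>\<^sub>\<ge>\<^sub>0" using False
          by (metis complex_nonneg_Reals_iff complex_of_real_def norm_of_real abs_of_nonneg complex_surj of_real_1 of_real_eq_iff complex.collapse)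
        then show ?thesis using continuous_at_Arg2pi isCont_def by blast
      qed
      then have "((\<lambda>y. Arg2pi (y $ i)) \<longlongrightarrow> Arg2pi (y $ i)) (at y within ?K)" for i
        by (intro isCont_tendsto_compose[of "y $ i" Arg2pi] tendsto_vec_nth tendsto_ident_at) (simp add: isCont_def)
      then have "(l \<longlongrightarrow> l y) (at y within ?K)"
        unfolding l_def by (intro tendsto_intros) auto
      then have "((\<lambda>y. g (l y)) \<longlongrightarrow> g (l y)) (at y within ?K)"
        using g by (intro isCont_tendsto_compose[of "l y" g]) (auto simp: continuous_on_eq_continuous_at)
      then show ?thesis using cut by (rule tendsto_mult)
    qed
  qed
qed

definition clamp_real :: "real \<Rightarrow> real \<Rightarrow> real" where
  "clamp_real M t = max (- M) (min M t)"

text \<open>A measurable function is almost everywhere the limit of continuous functions on \<open>\<real>\<^sup>d\<close>. Clamping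
  supplies the bound for dominated convergence, and the cutoff makes them continuous on the torus.\<close>

lemma approximable_clamped:
  fixes f :: "real ^ 'n \<Rightarrow> real"
  assumes f: "f \<in> borel_measurable torus" and M: "M \<ge> 0"
  shows "approximable (\<lambda>x. clamp_real M (f x))"
proof -
  have bd: "\<bar>clamp_real M t\<bar> \<le> M" for t using M by (simp add: clamp_real_def)
  have cc: "continuous_on S (clamp_real M)" for S
    unfolding clamp_real_def by (intro continuous_intros)
  have "f measurable_on cell"
    using f unfolding torus_eq by (subst measurable_on_iff_borel_measurable) auto
  then obtain N g where N: "negligible N" and g: "\<And>n. continuous_on UNIV (g n)"
    and lim: "\<And>x. x \<notin> N \<Longrightarrow> (\<lambda>n. g n x) \<longlonglongrightarrow> (if x \<in> cell then f x else 0)"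
    unfolding measurable_on_def by blast
  have fc: "(\<lambda>x. clamp_real M (f x)) \<in> borel_measurable torus"
    using f unfolding clamp_real_def by measurable
  have "AE x in torus. x \<notin> N"
  proof -
    have "AE x in lebesgue. x \<in> cell \<longrightarrow> x \<notin> N"
      using AE_not_in[of N lebesgue] N by (auto simp: negligible_iff_null_sets elim: eventually_mono)
    then show ?thesis unfolding torus_eq by (subst AE_restrict_space_iff) auto
  qed
  moreover note AE_torus_interior
  moreover have "AE x in torus. x \<in> (cell :: (real ^ 'n) set)" by (rule AE_I2) simp
  ultimately have lim': "AE x in torus. (\<lambda>n. clamp_real M (g n x) * cutoff n (circle_embedding x)) \<longlonglongrightarrow> clamp_real M (f x)"
  proof eventually_elim
    fix x :: "real ^ 'n" assume x: "x \<notin> N" "\<forall>i. 0 < x $ i \<and> x $ i < 1" "x \<in> cell"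
    have "circle_embedding x $ i \<noteq> 1" for i
    proof
      assume "circle_embedding x $ i = 1"
      then have "Arg2pi (circle_embedding x $ i) = 0" by (simp add: Arg2pi_eq_0)
      then show False using Arg2pi_circle_embedding[OF x(3), of i] x(2) by (metis div_0 less_irrefl)
    qed
    then have "(\<lambda>n. cutoff n (circle_embedding x)) \<longlonglongrightarrow> 1" by (rule cutoff_tendsto)
    moreover have "(\<lambda>n. clamp_real M (g n x)) \<longlonglongrightarrow> clamp_real M (f x)"
      using lim[OF x(1)] x(3) cc[of UNIV] by (intro isCont_tendsto_compose[of _ "clamp_real M"]) (auto simp: continuous_on_eq_continuous_at)
    ultimately show "(\<lambda>n. clamp_real M (g n x) * cutoff n (circle_embedding x)) \<longlonglongrightarrow> clamp_real M (f x)"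
      using tendsto_mult by fastforce
  qed
  show ?thesis
  proof (rule approximable_limit[OF _ _ _ lim'])
    show "(\<lambda>x. clamp_real M (f x)) \<in> L2" by (rule L2_bounded[OF fc, of M]) (simp add: bd)
    show "(\<lambda>x :: real ^ 'n. M) \<in> L2" by (rule L2_const)
    show "approximable (\<lambda>x. clamp_real M (g n x) * cutoff n (circle_embedding x))" for n
      by (rule approximable_cutoff_continuous[OF _ bd]) (rule continuous_on_compose2[OF cc[of UNIV] g], simp)
    show "\<bar>clamp_real M (g n x) * cutoff n (circle_embedding x)\<bar> \<le> \<bar>M\<bar>" for n x
      unfolding abs_mult using mult_mono[OF bd[of "g n x"], of "\<bar>cutoff n (circle_embedding x)\<bar>" 1]
        cutoff_bounds[of n "circle_embedding x"] M by simp
  qed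
qed

theorem approximable_L2:
  assumes "f \<in> L2"
  shows "approximable f"
proof (rule approximable_limit[OF assms assms])
  show "approximable (\<lambda>x. clamp_real (real n) (f x))" for n
    by (rule approximable_clamped) (simp_all add: L2_measurable[OF assms])
  show "AE x in torus. (\<lambda>n. clamp_real (real n) (f x)) \<longlonglongrightarrow> f x"
  proof (rule AE_I2, rule tendsto_eventually)
    fix x
    obtain m where "\<bar>f x\<bar> \<le> real m" using real_arch_simple by blast
    then have "clamp_real (real n) (f x) = f x" if "n \<ge> m" for n
      using that unfolding clamp_real_def by (smt (verit) of_nat_mono)
    then show "\<forall>\<^sub>F n in sequentially. clamp_real (real n) (f x) = f x"
      unfolding eventually_sequentially by blast
  qed
qed (auto simp: clamp_real_def)

text \<open>The error formula for trigonometric sums, applied to the coefficients of a good approximation, shows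
  that finitely many Fourier coefficients carry the norm of \<open>f\<close> up to \<open>\<epsilon>\<close>. In this form only finite sums
  have to be compared with Bessel's inequality.\<close>

lemma Parseval_approximate:
  assumes f: "f \<in> L2" and "\<epsilon> > 0"
  shows "\<exists>F. finite F \<and> (norm_L2 f)\<^sup>2 < (\<Sum>k\<in>F. (cmod (fourier f k))\<^sup>2) + \<epsilon>"
proof -
  obtain P where P: "trig_poly P" "(\<integral>x. (cmod (of_real (f x) - P x))\<^sup>2 \<partial>torus) < \<epsilon>"
    using approximable_L2[OF f] \<open>\<epsilon> > 0\<close> unfolding approximable_def by blast
  obtain F c where F: "finite F" "P = (\<lambda>x. \<Sum>k\<in>F. c k * character k x)"
    using P(1) unfolding trig_poly_def by blast
  have "0 \<le> (\<Sum>k\<in>F. (cmod (c k - fourier f k))\<^sup>2)" by (rule sum_nonneg) simp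
  then show ?thesis using P(2) F(1) unfolding F(2) norm_diff_trig_sum(2)[OF f F(1)] by (intro exI[of _ F]) simp
qed


section \<open>Smooth functions\<close>

lemma C_k_const: "C_k k (\<lambda>x. c)"
proof (induction k arbitrary: c)
  case (Suc k)
  show ?case by (simp, intro exI[of _ "\<lambda>_ _. 0"]) (auto intro: Suc)
qed simp

text \<open>The induction steps for products and inverses need \<open>f\<close> itself in the class of its derivative.\<close>

lemma C_k_Suc_imp: "C_k (Suc k) f \<Longrightarrow> C_k k f"
proof (induction k arbitrary: f)
  case 0
  then show ?case
    by (auto intro!: continuous_at_imp_continuous_on dest: has_derivative_continuous)
next
  case (Suc k)
  then obtain f' where "\<And>x. (f has_derivative f' x) (at x)" "\<And>v. C_k (Suc k) (\<lambda>x. f' x v)" by auto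
  then show ?case using Suc.IH unfolding C_k.simps(2)[of k f] by blast
qed

lemma C_k_add: "C_k k f \<Longrightarrow> C_k k g \<Longrightarrow> C_k k (\<lambda>x. f x + g x)"
proof (induction k arbitrary: f g)
  case 0
  then show ?case by (auto intro: continuous_on_add)
next
  case (Suc k)
  then obtain f' g' where f: "\<And>x. (f has_derivative f' x) (at x)" "\<And>v. C_k k (\<lambda>x. f' x v)"
    and g: "\<And>x. (g has_derivative g' x) (at x)" "\<And>v. C_k k (\<lambda>x. g' x v)" by auto
  show ?case using has_derivative_add[OF f(1) g(1)] Suc.IH[OF f(2) g(2)]
    by (auto intro!: exI[of _ "\<lambda>x v. f' x v + g' x v"])
qed

lemma C_k_mult: "C_k k f \<Longrightarrow> C_k k g \<Longrightarrow> C_k k (\<lambda>x. f x * g x)"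
proof (induction k arbitrary: f g)
  case 0
  then show ?case by (auto intro: continuous_on_mult)
next
  case (Suc k)
  note fk = C_k_Suc_imp[OF Suc.prems(1)] and gk = C_k_Suc_imp[OF Suc.prems(2)]
  obtain f' g' where f: "\<And>x. (f has_derivative f' x) (at x)" "\<And>v. C_k k (\<lambda>x. f' x v)"
    and g: "\<And>x. (g has_derivative g' x) (at x)" "\<And>v. C_k k (\<lambda>x. g' x v)" using Suc.prems by auto
  have "C_k k (\<lambda>x. f x * g' x v + f' x v * g x)" for v
    by (intro C_k_add Suc.IH fk gk f(2) g(2))
  then show ?case using has_derivative_mult[OF f(1) g(1)]
    by (auto intro!: exI[of _ "\<lambda>x v. f x * g' x v + f' x v * g x"])
qed

lemma has_derivative_trig:
  "((\<lambda>x. A * cos (b \<bullet> x) + B * sin (b \<bullet> x)) has_derivative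
     (\<lambda>v. (b \<bullet> v) * (B * cos (b \<bullet> x) - A * sin (b \<bullet> x)))) (at x)"
  by (auto intro!: derivative_eq_intros simp: algebra_simps)

lemma smooth_trig: "smooth (\<lambda>x. A * cos (b \<bullet> x) + B * sin (b \<bullet> x))"
proof -
  have "C_k k (\<lambda>x. A * cos (b \<bullet> x) + B * sin (b \<bullet> x))" for k
  proof (induction k arbitrary: A B)
    case 0
    show ?case by (simp, intro continuous_intros)
  next
    case (Suc k)
    have "C_k k (\<lambda>x. (b \<bullet> v) * (B * cos (b \<bullet> x) - A * sin (b \<bullet> x)))" for v
      using Suc[of "(b \<bullet> v) * B" "- (b \<bullet> v) * A"] by (simp add: algebra_simps)
    then show ?case using has_derivative_trig[of A b B]
      by (auto intro!: exI[of _ "\<lambda>x v. (b \<bullet> v) * (B * cos (b \<bullet> x) - A * sin (b \<bullet> x))"])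
  qed
  then show ?thesis by (simp add: smooth_def)
qed

lemma cos_sin_period: "cos (t + 2 * pi * of_int m) = cos t" "sin (t + 2 * pi * of_int m) = sin t"
proof -
  have "cis (t + 2 * pi * of_int m) = cis t"
    using cis_multiple_2pi[of "of_int m"] by (simp add: cis_mult[symmetric])
  then show "cos (t + 2 * pi * of_int m) = cos t" "sin (t + 2 * pi * of_int m) = sin t"
    by (auto simp: complex_eq_iff)
qed

lemma periodic_trig: "periodic (\<lambda>x. A * cos (freq k \<bullet> x) + B * sin (freq k \<bullet> x))"
  unfolding periodic_def
  by (simp add: inner_add_right inner_axis freq_def cos_sin_period)


section \<open>Weak gradients\<close>

lemma L2_component:
  fixes g :: "real ^ 'n \<Rightarrow> real ^ 'n"
  assumes "g \<in> L2"
  shows "(\<lambda>x. g x $ i) \<in> L2"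
proof -
  have [measurable]: "g \<in> borel_measurable torus" by (rule L2_measurable[OF assms])
  have m [measurable]: "(\<lambda>x. g x $ i) \<in> borel_measurable torus"
    using borel_measurable_inner[of g torus "\<lambda>_. axis i 1"] by (simp add: inner_axis)
  have "integrable torus (\<lambda>x. (norm (g x $ i))\<^sup>2)"
  proof (rule Bochner_Integration.integrable_bound[OF L2_square_integrable[OF assms]])
    show "AE x in torus. norm ((norm (g x $ i))\<^sup>2) \<le> norm ((norm (g x))\<^sup>2)"
      by (intro AE_I2) (metis component_le_norm_cart norm_ge_zero norm_power power_mono real_norm_def abs_norm_cancel)
  qed measurable
  then show ?thesis using m by (simp add: L2_def)
qed

lemma norm_L2_components:
  fixes g :: "real ^ 'n \<Rightarrow> real ^ 'n"
  assumes "g \<in> L2"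
  shows "(norm_L2 g)\<^sup>2 = (\<Sum>i\<in>UNIV. (norm_L2 (\<lambda>x. g x $ i))\<^sup>2)"
proof -
  have "(norm v)\<^sup>2 = (\<Sum>i\<in>UNIV. (norm (v $ i))\<^sup>2)" for v :: "real ^ 'n"
    unfolding norm_vec_def L2_set_def by (simp add: sum_nonneg)
  then have "(norm_L2 g)\<^sup>2 = (\<integral>x. (\<Sum>i\<in>UNIV. (norm (g x $ i))\<^sup>2) \<partial>torus)"
    by (simp add: norm_L2_square)
  also have "\<dots> = (\<Sum>i\<in>UNIV. (norm_L2 (\<lambda>x. g x $ i))\<^sup>2)"
    unfolding norm_L2_square
    by (rule Bochner_Integration.integral_sum) (rule L2_square_integrable[OF L2_component[OF assms]])
  finally show ?thesis .
qed

lemma fourier_diff: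
  assumes "f \<in> L2" "g \<in> L2"
  shows "fourier (\<lambda>x. f x - g x) k = fourier f k - fourier g k"
  unfolding fourier_def
  using Bochner_Integration.integral_diff[OF fourier_integrable[OF assms(1), of k] fourier_integrable[OF assms(2), of k]]
  by (simp add: algebra_simps)

lemma fourier_const: "fourier (\<lambda>x :: real ^ 'n. c) k = (if k = 0 then of_real c else 0)"
proof -
  have "fourier (\<lambda>x :: real ^ 'n. c) k = of_real c * (\<integral>x. character (- k) x \<partial>torus)"
    unfolding fourier_def character_minus[symmetric] by (rule integral_mult_right_zero)
  then show ?thesis by (simp add: integral_character)
qed

lemma fourier_Re_Im:
  assumes "f \<in> L2"
  shows "Re (fourier f k) = (\<integral>x. f x * cos (freq k \<bullet> x) \<partial>torus)"
    and "Im (fourier f k) = - (\<integral>x. f x * sin (freq k \<bullet> x) \<partial>torus)"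
  unfolding fourier_def
  using integral_Re[OF fourier_integrable[OF assms, of k]] integral_Im[OF fourier_integrable[OF assms, of k]]
  by (simp_all add: character_def)

lemma fourier_0: "f \<in> L2 \<Longrightarrow> fourier f 0 = of_real (torus_mean f)"
  using fourier_Re_Im[of f 0] by (simp add: complex_eq_iff torus_mean_eq)

text \<open>The real and imaginary parts are the definition of the weak gradient with \<open>\<eta>\<close> the sine and the cosine
  of \<open>freq k \<bullet> x\<close>.\<close>

lemma fourier_weak_gradient:
  assumes f: "f \<in> L2" and g: "g \<in> L2" and w: "is_weak_gradient f g"
  shows "fourier (\<lambda>x. g x $ i) k = \<i> * of_real (freq k $ i) * fourier f k"
proof -
  have weak: "(\<integral>x. f x * ((freq k $ i) * (B * cos (freq k \<bullet> x) - A * sin (freq k \<bullet> x))) \<partial>torus)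
      = - (\<integral>x. g x $ i * (A * cos (freq k \<bullet> x) + B * sin (freq k \<bullet> x)) \<partial>torus)" for A B
  proof -
    have "frechet_derivative (\<lambda>x. A * cos (freq k \<bullet> x) + B * sin (freq k \<bullet> x)) (at x)
        = (\<lambda>v. (freq k \<bullet> v) * (B * cos (freq k \<bullet> x) - A * sin (freq k \<bullet> x)))" for x
      by (rule frechet_derivative_at[OF has_derivative_trig, symmetric])
    then show ?thesis
      using w[unfolded is_weak_gradient_def, rule_format, OF conjI[OF smooth_trig periodic_trig], of A k B i]
      by (simp add: inner_axis)
  qed
  note gi = L2_component[OF g, of i]
  have int: "(\<integral>x. f x * (freq k $ i * h x) \<partial>torus) = freq k $ i * (\<integral>x. f x * h x \<partial>torus)" for h
    unfolding mult.left_commute[of "f _" "freq k $ i"] by (rule integral_mult_right_zero)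
  show ?thesis
    using weak[of 0 1] weak[of 1 0]
    by (simp add: complex_eq_iff fourier_Re_Im[OF f] fourier_Re_Im[OF gi] int[of "\<lambda>x. - sin (freq k \<bullet> x)", simplified] int)
qed

lemma norm_L2_eq_0: "f \<in> L2 \<Longrightarrow> norm_L2 f = 0 \<longleftrightarrow> (AE x in torus. f x = 0)"
  using integral_nonneg_eq_0_iff_AE[of torus "\<lambda>x. (norm (f x))\<^sup>2"] L2_square_integrable[of f]
  by (simp add: norm_L2_def)

lemma fourier_eq_0_imp:
  assumes "f \<in> L2" "\<And>k. fourier f k = 0"
  shows "AE x in torus. f x = 0"
proof -
  have "(norm_L2 f)\<^sup>2 \<le> 0"
  proof (rule field_le_epsilon)
    fix e :: real assume "e > 0"
    then show "(norm_L2 f)\<^sup>2 \<le> 0 + e" using Parseval_approximate[OF assms(1)] assms(2) by fastforce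
  qed
  then show ?thesis using norm_L2_eq_0[OF assms(1)] by simp
qed

text \<open>All Fourier coefficients of the components of \<open>g - g'\<close> vanish, because they are determined by
  those of \<open>f\<close>.\<close>

lemma weak_gradient_unique:
  fixes g g' :: "real ^ 'n \<Rightarrow> real ^ 'n"
  assumes f: "f \<in> L2" and g: "g \<in> L2" "is_weak_gradient f g" and g': "g' \<in> L2" "is_weak_gradient f g'"
  shows "AE x in torus. g x = g' x"
proof -
  have "AE x in torus. g x $ i - g' x $ i = 0" for i
    by (rule fourier_eq_0_imp)
       (simp_all add: L2_diff L2_component g g' fourier_diff fourier_weak_gradient[OF f])
  then have "AE x in torus. \<forall>i. g x $ i - g' x $ i = 0" by (subst AE_all_countable) auto
  then show ?thesis by eventually_elim (simp add: vec_eq_iff)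
qed

text \<open>Subtracting the mean removes the coefficient at \<open>k = 0\<close>; every other one is dominated by a
  coefficient of \<open>g\<close> because \<open>\<bar>2 \<pi> k\<^sub>j\<bar> \<ge> 1\<close> for some \<open>j\<close>.\<close>

theorem Poincare_inequality:
  fixes f :: "real ^ 'n \<Rightarrow> real"
  assumes f: "f \<in> L2" and g: "g \<in> L2" "is_weak_gradient f g"
  shows "(norm_L2 (\<lambda>x. f x - torus_mean f))\<^sup>2 \<le> (norm_L2 g)\<^sup>2"
proof -
  define h where "h x = f x - torus_mean f" for x
  have h: "h \<in> L2" unfolding h_def by (intro L2_diff f L2_const)
  have h_fourier: "fourier h k = fourier f k - (if k = 0 then of_real (torus_mean f) else 0)" for k
    unfolding h_def fourier_diff[OF f L2_const] fourier_const ..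
  have coeff: "(cmod (fourier h k))\<^sup>2 \<le> (\<Sum>i\<in>UNIV. (cmod (fourier (\<lambda>x. g x $ i) k))\<^sup>2)" for k
  proof (cases "k = 0")
    case True
    then show ?thesis by (simp add: h_fourier fourier_0[OF f] sum_nonneg)
  next
    case False
    then obtain j where j: "k $ j \<noteq> 0" by (auto simp: vec_eq_iff)
    have "1 * 1 \<le> 2 * pi * \<bar>real_of_int (k $ j)\<bar>"
      by (intro mult_mono) (use j pi_gt3 in auto)
    then have "1 \<le> \<bar>freq k $ j\<bar>" by (simp add: freq_def abs_mult)
    then have "(cmod (fourier f k))\<^sup>2 \<le> (\<bar>freq k $ j\<bar> * cmod (fourier f k))\<^sup>2"
      by (intro power_mono) (simp_all add: mult_le_cancel_right1)
    also have "\<dots> = (cmod (fourier (\<lambda>x. g x $ j) k))\<^sup>2"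
      by (simp add: fourier_weak_gradient[OF f g] norm_mult)
    also have "\<dots> \<le> (\<Sum>i\<in>UNIV. (cmod (fourier (\<lambda>x. g x $ i) k))\<^sup>2)"
      by (rule member_le_sum) auto
    finally show ?thesis using False by (simp add: h_fourier)
  qed
  have "(norm_L2 h)\<^sup>2 \<le> (norm_L2 g)\<^sup>2"
  proof (rule field_le_epsilon)
    fix e :: real assume "e > 0"
    then obtain F where F: "finite F" "(norm_L2 h)\<^sup>2 < (\<Sum>k\<in>F. (cmod (fourier h k))\<^sup>2) + e"
      using Parseval_approximate[OF h] by blast
    have "(\<Sum>k\<in>F. (cmod (fourier h k))\<^sup>2) \<le> (\<Sum>k\<in>F. \<Sum>i\<in>UNIV. (cmod (fourier (\<lambda>x. g x $ i) k))\<^sup>2)"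
      by (rule sum_mono[OF coeff])
    also have "\<dots> = (\<Sum>i\<in>UNIV. \<Sum>k\<in>F. (cmod (fourier (\<lambda>x. g x $ i) k))\<^sup>2)"
      by (rule sum.swap)
    also have "\<dots> \<le> (\<Sum>i\<in>UNIV. (norm_L2 (\<lambda>x. g x $ i))\<^sup>2)"
      by (intro sum_mono Bessel_inequality L2_component g F)
    also have "\<dots> = (norm_L2 g)\<^sup>2" by (rule norm_L2_components[OF g(1), symmetric])
    finally show "(norm_L2 h)\<^sup>2 \<le> (norm_L2 g)\<^sup>2 + e" using F(2) by simp
  qed
  then show ?thesis unfolding h_def .
qed


section \<open>The space of weakly differentiable functions\<close>

lemma H1_L2: "f \<in> H1 \<Longrightarrow> f \<in> L2"
  by (simp add: H1_def)

lemma wgrad: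
  assumes "f \<in> H1"
  shows "wgrad f \<in> L2" "is_weak_gradient f (wgrad f)"
proof -
  have "\<exists>g. g \<in> L2 \<and> is_weak_gradient f g" using assms by (auto simp: H1_def)
  then have "wgrad f \<in> L2 \<and> is_weak_gradient f (wgrad f)" unfolding wgrad_def by (rule someI_ex)
  then show "wgrad f \<in> L2" "is_weak_gradient f (wgrad f)" by auto
qed

lemma wgrad_eqI:
  assumes "f \<in> L2" "g \<in> L2" "is_weak_gradient f g"
  shows "f \<in> H1" "AE x in torus. wgrad f x = g x"
proof -
  show f: "f \<in> H1" using assms by (auto simp: H1_def)
  show "AE x in torus. wgrad f x = g x"
    by (rule weak_gradient_unique) (use assms wgrad[OF f] in auto)
qed

lemma wgrad_scale:
  fixes f :: "real ^ 'n \<Rightarrow> real"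
  assumes "f \<in> H1"
  shows "(\<lambda>x. c * f x) \<in> H1" "AE x in torus. wgrad (\<lambda>x. c * f x) x = c *\<^sub>R wgrad f x"
proof -
  have w: "is_weak_gradient (\<lambda>x. c * f x) (\<lambda>x. c *\<^sub>R wgrad f x)"
    using wgrad(2)[OF assms] unfolding is_weak_gradient_def by (simp add: mult.assoc)
  have f: "(\<lambda>x. c * f x) \<in> L2" using L2_scaleR[OF H1_L2[OF assms], of c] by simp
  have g: "(\<lambda>x. c *\<^sub>R wgrad f x) \<in> L2" by (rule L2_scaleR[OF wgrad(1)[OF assms]])
  show "(\<lambda>x. c * f x) \<in> H1" "AE x in torus. wgrad (\<lambda>x. c * f x) x = c *\<^sub>R wgrad f x"
    using wgrad_eqI[OF f g w] by auto
qed

text \<open>That the zero field is a weak gradient of a constant means that partial derivatives of periodic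
  functions have integral \<open>0\<close>.\<close>

lemma wgrad_const:
  "(\<lambda>x :: real ^ 'n. c) \<in> H1" "AE x in torus. wgrad (\<lambda>x :: real ^ 'n. c) x = 0"
proof -
  have w: "is_weak_gradient (\<lambda>x :: real ^ 'n. c) (\<lambda>x. 0)"
    unfolding is_weak_gradient_def
  proof (intro allI impI)
    fix \<eta> :: "real ^ 'n \<Rightarrow> real" and i assume \<eta>: "smooth \<eta> \<and> periodic \<eta>"
    then have "C_k (Suc 0) \<eta>" by (auto simp: smooth_def)
    then obtain \<eta>' where \<eta>': "\<And>x. (\<eta> has_derivative \<eta>' x) (at x)" "\<And>v. continuous_on UNIV (\<lambda>x. \<eta>' x v)" by auto
    have "(\<integral>x. \<eta>' x (axis i 1) \<partial>torus) = 0"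
      by (rule integral_periodic_derivative[OF \<eta>']) (use \<eta> in \<open>auto simp: periodic_def\<close>)
    then show "(\<integral>x. c * frechet_derivative \<eta> (at x) (axis i 1) \<partial>torus) = - (\<integral>x. 0 $ i * \<eta> x \<partial>torus)"
      by (simp add: frechet_derivative_at[OF \<eta>'(1), symmetric])
  qed
  show "(\<lambda>x :: real ^ 'n. c) \<in> H1" "AE x in torus. wgrad (\<lambda>x :: real ^ 'n. c) x = 0"
    using wgrad_eqI[OF L2_const L2_zero w] by auto
qed

lemma norm_L2_cong_AE: "AE x in torus. f x = g x \<Longrightarrow> norm_L2 f = norm_L2 g"
  unfolding norm_L2_def
  by (intro arg_cong[where f = sqrt] torus.integral_cong_AE') (auto elim: eventually_mono)

lemma norm_L2_scaleR: "norm_L2 (\<lambda>x. c *\<^sub>R f x) = \<bar>c\<bar> * norm_L2 f"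
  unfolding norm_L2_def by (simp add: power_mult_distrib real_sqrt_mult)

text \<open>Since \<open>wgrad\<close> chooses a representative for each function separately, homogeneity rests on the
  uniqueness of weak gradients.\<close>

lemma norm_H1_scale:
  assumes "f \<in> H1"
  shows "norm_H1 (\<lambda>x. c * f x) = \<bar>c\<bar> * norm_H1 f"
proof -
  have "norm_L2 (\<lambda>x. c * f x) = \<bar>c\<bar> * norm_L2 f" using norm_L2_scaleR[of c f] by simp
  moreover have "norm_L2 (wgrad (\<lambda>x. c * f x)) = \<bar>c\<bar> * norm_L2 (wgrad f)"
    using norm_L2_cong_AE[OF wgrad_scale(2)[OF assms]] norm_L2_scaleR by metis
  ultimately have "norm_H1 (\<lambda>x. c * f x) = sqrt (c\<^sup>2 * ((norm_L2 f)\<^sup>2 + (norm_L2 (wgrad f))\<^sup>2))"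
    by (simp add: norm_H1_def power_mult_distrib distrib_left)
  then show ?thesis by (simp add: norm_H1_def real_sqrt_mult)
qed


section \<open>A smooth step function\<close>

text \<open>The classical function \<open>exp (- 1 / x)\<close> is the member \<open>n = 0\<close> of this family. The derivatives of the
  family are combinations of its members, which yields smoothness of all of them at once.\<close>

definition flat :: "nat \<Rightarrow> real \<Rightarrow> real" where
  "flat n x = (if x > 0 then (1 / x) ^ n * exp (- (1 / x)) else 0)"

lemma flat_tendsto_0: "(flat n \<longlongrightarrow> 0) (at 0)"
proof (rule filterlim_split_at_real)
  show "(flat n \<longlongrightarrow> 0) (at_left 0)"
    by (rule tendsto_eventually) (auto simp: eventually_at_filter flat_def)
  have "((\<lambda>y :: real. y ^ n / exp y) \<longlongrightarrow> 0) at_top" by (rule tendsto_power_div_exp_0)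
  then have "((\<lambda>x :: real. inverse x ^ n / exp (inverse x)) \<longlongrightarrow> 0) (at_right 0)"
    by (rule filterlim_compose[OF _ filterlim_inverse_at_top_right])
  then show "(flat n \<longlongrightarrow> 0) (at_right 0)"
    by (rule Lim_transform_eventually)
       (auto simp: eventually_at_filter flat_def exp_minus field_simps)
qed

lemma flat_has_derivative: "(flat n has_real_derivative flat (n + 2) x - real n * flat (n + 1) x) (at x)"
proof -
  consider "x < 0" | "x = 0" | "x > 0" by linarith
  then show ?thesis
  proof cases
    case 1
    have "((\<lambda>_. 0) has_real_derivative flat (n + 2) x - real n * flat (n + 1) x) (at x)"
      using 1 by (simp add: flat_def)
    then show ?thesis
      by (rule has_field_derivative_transform_within_open[of _ _ _ "{..<0}"]) (use 1 in \<open>auto simp: flat_def\<close>)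
  next
    case 2
    have "((\<lambda>t. (flat n t - flat n 0) / (t - 0)) \<longlongrightarrow> 0) (at 0)"
      using flat_tendsto_0[of "Suc n"]
      by (rule Lim_transform_eventually) (auto simp: flat_def field_simps eventually_at_filter)
    then show ?thesis using 2 by (simp add: has_field_derivative_iff flat_def)
  next
    case 3
    have "((\<lambda>x. (1 / x) ^ n * exp (- (1 / x))) has_real_derivative flat (n + 2) x - real n * flat (n + 1) x) (at x)"
    proof -
      define y where "y = 1 / x"
      have inv: "((\<lambda>x. 1 / x) has_real_derivative - (y\<^sup>2)) (at x)"
        using 3 by (auto intro!: derivative_eq_intros simp: y_def field_simps power2_eq_square)
      have power: "((\<lambda>x. (1 / x) ^ n) has_real_derivative - (real n * y ^ (n + 1))) (at x)"
        using DERIV_power[OF inv, of n]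
        by (rule DERIV_cong) (cases n, simp_all add: y_def[symmetric] power2_eq_square)
      have "((\<lambda>x. exp (- (1 / x))) has_real_derivative exp (- y) * - (- (y\<^sup>2))) (at x)"
        unfolding y_def by (rule DERIV_chain2[OF DERIV_exp DERIV_minus[OF inv[unfolded y_def]]])
      from DERIV_mult[OF power this] show ?thesis
        by (rule DERIV_cong)
           (use 3 in \<open>simp add: y_def[symmetric] flat_def algebra_simps power_add power2_eq_square\<close>)
    qed
    then show ?thesis
      by (rule has_field_derivative_transform_within_open[of _ _ _ "{0<..}"]) (use 3 in \<open>auto simp: flat_def\<close>)
  qed
qed

lemma C_k_Suc_real:
  fixes f :: "real \<Rightarrow> real"
  assumes "\<And>x. (f has_real_derivative f' x) (at x)" "C_k k f'"
  shows "C_k (Suc k) f"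
  using assms(1) C_k_mult[OF assms(2) C_k_const]
  by (auto simp: has_field_derivative_def intro!: exI[of _ "\<lambda>x v. f' x * v"])

lemma C_k_flat: "C_k k (flat n)"
proof (induction k arbitrary: n)
  case 0
  show ?case using flat_has_derivative[THEN DERIV_isCont]
    by (simp add: continuous_at_imp_continuous_on)
next
  case (Suc k)
  have "C_k k (\<lambda>x. flat (n + 2) x + (- real n) * flat (n + 1) x)"
    by (intro C_k_add C_k_mult C_k_const Suc)
  then show ?case by (intro C_k_Suc_real[OF flat_has_derivative]) simp
qed

lemma C_k_affine:
  fixes f :: "real \<Rightarrow> real"
  shows "C_k k f \<Longrightarrow> C_k k (\<lambda>x. f (a * x + b))"
proof (induction k arbitrary: f)
  case 0
  then show ?case by (auto intro!: continuous_on_compose2[of UNIV f] continuous_intros)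
next
  case (Suc k)
  then obtain f' where f': "\<And>x. (f has_derivative f' x) (at x)" "\<And>v. C_k k (\<lambda>x. f' x v)" by auto
  have "((\<lambda>x. f (a * x + b)) has_derivative (\<lambda>v. f' (a * x + b) (a * v))) (at x)" for x
    by (rule has_derivative_compose[OF _ f'(1)]) (auto intro!: derivative_eq_intros)
  then show ?case using Suc.IH[OF f'(2)]
    by (auto intro!: exI[of _ "\<lambda>x v. f' (a * x + b) (a * v)"])
qed

lemma C_k_inverse: "C_k k f \<Longrightarrow> (\<And>x. f x \<noteq> 0) \<Longrightarrow> C_k k (\<lambda>x. inverse (f x))"
proof (induction k arbitrary: f)
  case 0
  then show ?case by (auto intro: continuous_on_inverse)
next
  case (Suc k)
  obtain f' where f': "\<And>x. (f has_derivative f' x) (at x)" "\<And>v. C_k k (\<lambda>x. f' x v)"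
    using Suc.prems by auto
  have inv: "C_k k (\<lambda>x. inverse (f x))" using Suc.IH[OF C_k_Suc_imp[OF Suc.prems(1)]] Suc.prems(2) by blast
  have "C_k k (\<lambda>x. (- 1) * (inverse (f x) * f' x v * inverse (f x)))" for v
    by (intro C_k_mult C_k_const inv f'(2))
  then show ?case using Deriv.has_derivative_inverse[OF Suc.prems(2) f'(1)]
    by (auto intro!: exI[of _ "\<lambda>x v. - (inverse (f x) * f' x v * inverse (f x))"])
qed

definition smooth_step :: "real \<Rightarrow> real" where
  "smooth_step x = flat 0 x * inverse (flat 0 x + flat 0 (1 - x))"

lemma flat_sum_pos: "flat 0 x + flat 0 (1 - x) > 0"
  by (auto simp: flat_def intro: add_pos_pos)

lemma smooth_step_C_k: "C_k k smooth_step"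
proof -
  have "C_k k (\<lambda>x. flat 0 (1 - x))" using C_k_affine[OF C_k_flat, of k 0 "-1" 1] by simp
  then have "C_k k (\<lambda>x. inverse (flat 0 x + flat 0 (1 - x)))"
    using flat_sum_pos by (intro C_k_inverse C_k_add C_k_flat) (auto simp: less_le)
  then show ?thesis unfolding smooth_step_def[abs_def] by (intro C_k_mult C_k_flat)
qed

lemma smooth_step_0: "x \<le> 0 \<Longrightarrow> smooth_step x = 0"
  by (simp add: smooth_step_def flat_def)

lemma smooth_step_1: "x \<ge> 1 \<Longrightarrow> smooth_step x = 1"
  by (simp add: smooth_step_def flat_def)

lemma smooth_step_bounds: "0 \<le> smooth_step x" "smooth_step x \<le> 1"
proof -
  have "0 \<le> flat 0 y" for y by (simp add: flat_def)
  then show "0 \<le> smooth_step x" "smooth_step x \<le> 1"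
    using flat_sum_pos[of x] by (auto simp: smooth_step_def field_simps)
qed

lemma smooth_step_derivative:
  obtains \<rho> M where "\<And>x. (smooth_step has_real_derivative \<rho> x) (at x)" "continuous_on UNIV \<rho>"
    "\<And>x. \<bar>\<rho> x\<bar> \<le> M" "\<And>x. x \<notin> {0..1} \<Longrightarrow> \<rho> x = 0"
proof -
  obtain \<rho>' where \<rho>': "\<And>x. (smooth_step has_derivative \<rho>' x) (at x)" "\<And>v. continuous_on UNIV (\<lambda>x. \<rho>' x v)"
    using smooth_step_C_k[of "Suc 0"] by auto
  define \<rho> where "\<rho> x = \<rho>' x 1" for x
  have d: "(smooth_step has_real_derivative \<rho> x) (at x)" for x
  proof -
    have "\<rho>' x = (*) (\<rho> x)"
    proof
      fix v
      show "\<rho>' x v = \<rho> x * v"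
        using linear_scale[OF has_derivative_linear[OF \<rho>'(1)[of x]], of v 1] by (simp add: \<rho>_def)
    qed
    then show ?thesis using \<rho>'(1)[of x] by (simp add: has_field_derivative_def)
  qed
  have c: "continuous_on UNIV \<rho>" unfolding \<rho>_def by (rule \<rho>'(2))
  have z: "\<rho> x = 0" if x: "x \<notin> {0..1}" for x
  proof (rule DERIV_unique[OF d])
    consider "x < 0" | "x > 1" using x by fastforce
    then show "(smooth_step has_real_derivative 0) (at x)"
    proof cases
      case 1
      show ?thesis
        by (rule has_field_derivative_transform_within_open[of "\<lambda>_. 0" _ _ "{..<0}"])
           (use 1 smooth_step_0 in auto)
    next
      case 2
      show ?thesis
        by (rule has_field_derivative_transform_within_open[of "\<lambda>_. 1" _ _ "{1<..}"])
           (use 2 smooth_step_1 in auto)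
    qed
  qed
  have "bounded (\<rho> ` {0..1})"
    by (intro compact_imp_bounded compact_continuous_image continuous_on_subset[OF c]) auto
  then obtain M where M: "\<And>x. x \<in> {0..1} \<Longrightarrow> \<bar>\<rho> x\<bar> \<le> M"
    unfolding bounded_iff by (metis imageI real_norm_def)
  have "\<bar>\<rho> x\<bar> \<le> M" for x
    using M[of x] M[of 0] z[of x] by (cases "x \<in> {0..1}") auto
  then show thesis using that d c z by blast
qed


section \<open>Weak time derivatives and increments\<close>

lemma smooth_step_rescaled_derivative:
  assumes step: "\<And>x. (smooth_step has_real_derivative \<rho> x) (at x)"
  shows "((\<lambda>\<tau>. smooth_step (N * (\<tau> - r))) has_real_derivative N * \<rho> (N * (\<tau> - r))) (at \<tau> within S)"
proof -
  have "((\<lambda>\<tau>. N * (\<tau> - r)) has_real_derivative N) (at \<tau> within S)"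
    by (auto intro!: derivative_eq_intros)
  from DERIV_chain2[OF step this] show ?thesis by (simp add: mult.commute)
qed

text \<open>The kernels \<open>N \<rho>(N(\<tau> - s))\<close> have integral \<open>1\<close> and are supported in \<open>[s, s + 1/N]\<close>, so that they converge
  to the point mass at \<open>s\<close>; the bound on \<open>\<rho>\<close> keeps their total variation bounded.\<close>

lemma mollified_point_value:
  fixes c \<rho> :: "real \<Rightarrow> real"
  assumes step: "\<And>x. (smooth_step has_real_derivative \<rho> x) (at x)"
    and \<rho>: "continuous_on UNIV \<rho>" "\<And>x. \<bar>\<rho> x\<bar> \<le> M" "\<And>x. x \<notin> {0..1} \<Longrightarrow> \<rho> x = 0"
    and c: "continuous_on {0..} c" and s: "0 < s" "s + 1 \<le> T"
  shows "(\<lambda>n. integral {0..T} (\<lambda>\<tau>. real (Suc n) * \<rho> (real (Suc n) * (\<tau> - s)) * c \<tau>)) \<longlonglongrightarrow> c s"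
proof (rule LIMSEQ_I)
  fix \<epsilon> :: real assume \<epsilon>: "\<epsilon> > 0"
  have M0: "M \<ge> 0" using \<rho>(2)[of 0] by linarith
  define \<delta> where "\<delta> = \<epsilon> / (2 * (M + 1))"
  have \<delta>: "\<delta> > 0" using \<epsilon> M0 by (simp add: \<delta>_def)
  obtain d where d: "d > 0" "\<And>\<tau>. \<tau> \<in> {0..} \<Longrightarrow> dist \<tau> s < d \<Longrightarrow> dist (c \<tau>) (c s) < \<delta>"
    using c[unfolded continuous_on_iff] s \<delta> by (metis atLeast_iff less_imp_le)
  obtain n0 where n0: "1 / d < real n0" using reals_Archimedean2 by blast
  show "\<exists>no. \<forall>n\<ge>no. norm (integral {0..T} (\<lambda>\<tau>. real (Suc n) * \<rho> (real (Suc n) * (\<tau> - s)) * c \<tau>) - c s) < \<epsilon>"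
  proof (intro exI[of _ n0] allI impI)
    fix n assume "n \<ge> n0"
    define N where "N = real (Suc n)"
    have N: "N \<ge> 1" "1 / N < d"
    proof -
      show "N \<ge> 1" by (simp add: N_def)
      have "1 / d < N" using n0 \<open>n \<ge> n0\<close> by (simp add: N_def)
      then show "1 / N < d" using d(1) \<open>N \<ge> 1\<close> by (simp add: field_simps)
    qed
    define J where "J = {s..s + 1 / N}"
    have "1 / N \<le> 1" using N(1) by simp
    then have J: "J \<subseteq> {0..T}" using s by (auto simp: J_def)
    have \<rho>c: "continuous_on S (\<lambda>\<tau>. N * \<rho> (N * (\<tau> - s)))" for S
      by (intro continuous_intros continuous_on_compose2[OF \<rho>(1)]) auto
    have cT: "continuous_on {0..T} c" by (rule continuous_on_subset[OF c]) auto
    have off: "\<rho> (N * (\<tau> - s)) = 0" if "\<tau> \<notin> J" for \<tau>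
    proof (rule \<rho>(3))
      have "\<tau> < s \<or> 1 / N < \<tau> - s" using that by (auto simp: J_def)
      then show "N * (\<tau> - s) \<notin> {0..1}"
        using N(1) by (auto simp: zero_le_mult_iff pos_divide_less_eq mult.commute)
    qed
    \<comment> \<open>The kernel is the derivative of a rescaled step from \<open>0\<close> to \<open>1\<close>.\<close>
    have one: "((\<lambda>\<tau>. N * \<rho> (N * (\<tau> - s))) has_integral 1) {0..T}"
    proof -
      have "((\<lambda>\<tau>. N * \<rho> (N * (\<tau> - s))) has_integral smooth_step (N * (T - s)) - smooth_step (N * (0 - s))) {0..T}"
      proof (rule fundamental_theorem_of_calculus)
        show "0 \<le> T" using s by simp
        show "((\<lambda>\<tau>. smooth_step (N * (\<tau> - s))) has_vector_derivative N * \<rho> (N * (\<tau> - s))) (at \<tau> within {0..T})" for \<tau>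
          unfolding has_real_derivative_iff_has_vector_derivative[symmetric]
          by (rule smooth_step_rescaled_derivative[OF step])
      qed
      moreover have "smooth_step (N * (T - s)) = 1"
        using mult_mono[of 1 N 1 "T - s"] N s by (intro smooth_step_1) auto
      moreover have "smooth_step (N * (0 - s)) = 0"
        using N s by (intro smooth_step_0) (auto simp: mult_le_0_iff)
      ultimately show ?thesis by simp
    qed
    have int: "(\<lambda>\<tau>. N * \<rho> (N * (\<tau> - s)) * c \<tau>) integrable_on {0..T}"
      by (intro integrable_continuous_real continuous_on_mult \<rho>c cT)
    have "((\<lambda>\<tau>. N * \<rho> (N * (\<tau> - s)) * c \<tau> - N * \<rho> (N * (\<tau> - s)) * c s) has_integral
        integral {0..T} (\<lambda>\<tau>. N * \<rho> (N * (\<tau> - s)) * c \<tau>) - 1 * c s) {0..T}"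
      by (intro has_integral_diff integrable_integral int has_integral_mult_left one)
    then have hi: "((\<lambda>\<tau>. N * \<rho> (N * (\<tau> - s)) * (c \<tau> - c s)) has_integral
        integral {0..T} (\<lambda>\<tau>. N * \<rho> (N * (\<tau> - s)) * c \<tau>) - c s) {0..T}"
      by (simp add: right_diff_distrib)
    define D where "D = integral {0..T} (\<lambda>\<tau>. N * \<rho> (N * (\<tau> - s)) * c \<tau>) - c s"
    have "((\<lambda>\<tau>. N * \<rho> (N * (\<tau> - s)) * (c \<tau> - c s)) has_integral D) J"
      using hi off has_integral_restrict[OF J, of "\<lambda>\<tau>. N * \<rho> (N * (\<tau> - s)) * (c \<tau> - c s)" D]
      unfolding D_def by (smt (verit, best) has_integral_cong mult_eq_0_iff)
    then have D: "((\<lambda>\<tau>. N * \<rho> (N * (\<tau> - s)) * (c \<tau> - c s)) has_integral D) {s..s + 1 / N}"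
      by (simp only: J_def)
    have bound: "norm (N * \<rho> (N * (\<tau> - s)) * (c \<tau> - c s)) \<le> N * M * \<delta>" if "\<tau> \<in> {s..s + 1 / N} - {}" for \<tau>
    proof -
      have "dist \<tau> s < d" using that N by (auto simp: dist_real_def)
      then have "\<bar>c \<tau> - c s\<bar> \<le> \<delta>" using d(2)[of \<tau>] that s by (auto simp: dist_real_def)
      then have "\<bar>N\<bar> * \<bar>\<rho> (N * (\<tau> - s))\<bar> * \<bar>c \<tau> - c s\<bar> \<le> N * M * \<delta>"
        using N M0 by (intro mult_mono \<rho>(2)) auto
      then show ?thesis by (simp add: abs_mult)
    qed
    have "norm D \<le> (N * M * \<delta>) * measure lborel J"
      unfolding J_def by (rule has_integral_bound_real[OF _ _ D bound]) (use N M0 \<delta> in auto)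
    also have "measure lborel J = 1 / N" using N by (simp add: J_def)
    also have "N * M * \<delta> * (1 / N) = M * \<delta>" using N by simp
    also have "M * \<delta> < \<epsilon>" using M0 \<epsilon> by (simp add: \<delta>_def field_simps) (smt (verit) mult_nonneg_nonneg)
    finally show "norm (integral {0..T} (\<lambda>\<tau>. real (Suc n) * \<rho> (real (Suc n) * (\<tau> - s)) * c \<tau>) - c s) < \<epsilon>"
      unfolding D_def N_def .
  qed
qed

lemma integral_lebesgue_on_initial:
  fixes f :: "real \<Rightarrow> real"
  shows "(\<integral>t. f t \<partial>lebesgue_on {0<..<T}) = (\<integral>t. indicator {0<..<T} t * f t \<partial>lebesgue_on {0<..})"
proof -
  have "(\<integral>t. f t \<partial>lebesgue_on {0<..<T}) = (\<integral>t. indicator {0<..<T} t * f t \<partial>lebesgue)"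
    by (subst integral_restrict_space) auto
  also have "\<dots> = (\<integral>t. indicator {0<..} t * (indicator {0<..<T} t * f t) \<partial>lebesgue)"
    by (rule Bochner_Integration.integral_cong) (auto simp: indicator_def)
  also have "\<dots> = (\<integral>t. indicator {0<..<T} t * f t \<partial>lebesgue_on {0<..})"
    by (subst integral_restrict_space) auto
  finally show ?thesis .
qed

text \<open>The test functions increase from \<open>0\<close> to \<open>1\<close> right after \<open>s\<close> and decrease back to \<open>0\<close> right after \<open>t\<close>. In
  the limit their derivative becomes the difference of point masses at \<open>s\<close> and \<open>t\<close>, while the functions
  themselves tend to the indicator of \<open>(s, t]\<close>.\<close>

lemma weak_derivative_increment:
  fixes c q :: "real \<Rightarrow> real"
  assumes c: "continuous_on {0..} c"
    and q_meas: "q \<in> borel_measurable (lebesgue_on {0<..})"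
    and q: "\<And>T. T > 0 \<Longrightarrow> integrable (lebesgue_on {0<..}) (\<lambda>t. indicator {0<..T} t * q t)"
    and weak: "\<And>T \<psi>. T > 0 \<Longrightarrow> test_function T \<psi> \<Longrightarrow>
      (\<integral>t. deriv \<psi> t * c t \<partial>lebesgue_on {0<..<T}) = (\<integral>t. \<psi> t * q t \<partial>lebesgue_on {0<..<T})"
    and st: "0 < s" "s < t"
  shows "c t - c s = - (\<integral>\<tau>. indicator {s<..t} \<tau> * q \<tau> \<partial>lebesgue_on {0<..})"
proof -
  obtain \<rho> M where step: "\<And>x. (smooth_step has_real_derivative \<rho> x) (at x)"
    and \<rho>: "continuous_on UNIV \<rho>" "\<And>x. \<bar>\<rho> x\<bar> \<le> M" "\<And>x. x \<notin> {0..1} \<Longrightarrow> \<rho> x = 0"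
    by (rule smooth_step_derivative) blast
  define T where "T = t + 2"
  have T: "T > 0" "s + 1 \<le> T" "t + 1 \<le> T" using st by (auto simp: T_def)
  define \<psi> where "\<psi> n \<tau> = smooth_step (real (Suc n) * (\<tau> - s)) - smooth_step (real (Suc n) * (\<tau> - t))" for n \<tau>
  define k where "k n r \<tau> = real (Suc n) * \<rho> (real (Suc n) * (\<tau> - r))" for n r \<tau>
  have k_cont: "continuous_on S (k n r)" for S n r
    unfolding k_def by (intro continuous_intros continuous_on_compose2[OF \<rho>(1)]) auto
  have deriv: "deriv (\<psi> n) \<tau> = k n s \<tau> - k n t \<tau>" for n \<tau>
  proof (rule DERIV_imp_deriv)
    show "(\<psi> n has_real_derivative k n s \<tau> - k n t \<tau>) (at \<tau>)"
      unfolding \<psi>_def k_def by (intro DERIV_diff smooth_step_rescaled_derivative[OF step])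
  qed
  have \<psi>_off: "\<psi> n \<tau> = 0" if "\<tau> \<notin> {s..t + 1}" for n \<tau>
  proof -
    consider "\<tau> < s" | "\<tau> > t + 1" using \<open>\<tau> \<notin> _\<close> by fastforce
    then show ?thesis
    proof cases
      case 1
      then have "real (Suc n) * (\<tau> - s) \<le> 0" "real (Suc n) * (\<tau> - t) \<le> 0"
        using st by (auto simp: mult_le_0_iff)
      then show ?thesis by (simp only: \<psi>_def smooth_step_0)
    next
      case 2
      then have "1 * 1 \<le> real (Suc n) * (\<tau> - s)" "1 * 1 \<le> real (Suc n) * (\<tau> - t)"
        using st by (intro mult_mono; simp)+
      then show ?thesis by (simp add: \<psi>_def smooth_step_1)
    qed
  qed
  have test: "test_function T (\<psi> n)" for n
    unfolding test_function_def
  proof (intro conjI exI[of _ "{s..t + 1}"])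
    have "C_k m (\<lambda>\<tau>. smooth_step (N * \<tau> + - (N * s)) + (- 1) * smooth_step (N * \<tau> + - (N * t)))" for N m
      by (intro C_k_add C_k_mult C_k_const C_k_affine smooth_step_C_k)
    then have "C_k m (\<lambda>\<tau>. smooth_step (N * (\<tau> - s)) - smooth_step (N * (\<tau> - t)))" for N m
      by (simp add: right_diff_distrib)
    then show "smooth (\<psi> n)" unfolding smooth_def \<psi>_def by blast
  qed (use st \<psi>_off T_def in auto)
  have lhs: "(\<integral>\<tau>. deriv (\<psi> n) \<tau> * c \<tau> \<partial>lebesgue_on {0<..<T})
      = integral {0..T} (\<lambda>\<tau>. k n s \<tau> * c \<tau>) - integral {0..T} (\<lambda>\<tau>. k n t \<tau> * c \<tau>)" for n
  proof -
    have cT: "continuous_on {0..T} c" by (rule continuous_on_subset[OF c]) auto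
    have cont: "continuous_on {0..T} (\<lambda>\<tau>. k n s \<tau> * c \<tau> - k n t \<tau> * c \<tau>)"
      by (intro continuous_intros k_cont cT)
    have "integrable (lebesgue_on {0<..<T}) (\<lambda>\<tau>. k n s \<tau> * c \<tau> - k n t \<tau> * c \<tau>)"
      by (rule absolutely_integrable_imp_integrable[OF set_integrable_subset[OF absolutely_integrable_continuous_real[OF cont]]]) auto
    then have "(\<integral>\<tau>. k n s \<tau> * c \<tau> - k n t \<tau> * c \<tau> \<partial>lebesgue_on {0<..<T})
        = integral {0<..<T} (\<lambda>\<tau>. k n s \<tau> * c \<tau> - k n t \<tau> * c \<tau>)"
      by (rule lebesgue_integral_eq_integral) simp
    also have "\<dots> = integral {0..T} (\<lambda>\<tau>. k n s \<tau> * c \<tau> - k n t \<tau> * c \<tau>)"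
      by (rule integral_open_interval_real[symmetric])
    also have "\<dots> = integral {0..T} (\<lambda>\<tau>. k n s \<tau> * c \<tau>) - integral {0..T} (\<lambda>\<tau>. k n t \<tau> * c \<tau>)"
      by (intro Henstock_Kurzweil_Integration.integral_diff integrable_continuous_real continuous_intros k_cont cT)
    finally show ?thesis by (simp add: deriv left_diff_distrib)
  qed
  have "(\<lambda>n. \<integral>\<tau>. deriv (\<psi> n) \<tau> * c \<tau> \<partial>lebesgue_on {0<..<T}) \<longlonglongrightarrow> c s - c t"
    unfolding lhs k_def
    by (intro tendsto_diff mollified_point_value[OF step \<rho> c]) (use st T in auto)
  moreover have "(\<lambda>n. \<integral>\<tau>. \<psi> n \<tau> * q \<tau> \<partial>lebesgue_on {0<..<T}) \<longlonglongrightarrow> (\<integral>\<tau>. indicator {s<..t} \<tau> * q \<tau> \<partial>lebesgue_on {0<..})"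
    unfolding integral_lebesgue_on_initial
  proof (rule integral_dominated_convergence)
    have \<psi>_meas: "\<psi> n \<in> borel_measurable (lebesgue_on {0<..})" for n
    proof -
      have "continuous_on UNIV (\<psi> n)"
        unfolding \<psi>_def using smooth_step_C_k[of 0]
        by (auto intro!: continuous_intros continuous_on_compose2[of UNIV smooth_step])
      then show ?thesis
        by (rule continuous_imp_measurable_on_sets_lebesgue[OF continuous_on_subset]) simp_all
    qed
    show "(\<lambda>\<tau>. indicator {s<..t} \<tau> * q \<tau>) \<in> borel_measurable (lebesgue_on {0<..})"
      by (intro borel_measurable_times borel_measurable_indicator q_meas)
         (use st in \<open>auto simp: sets_restrict_space_iff\<close>)
    show "(\<lambda>\<tau>. indicator {0<..<T} \<tau> * (\<psi> n \<tau> * q \<tau>)) \<in> borel_measurable (lebesgue_on {0<..})" for n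
      by (intro borel_measurable_times borel_measurable_indicator q_meas \<psi>_meas)
         (auto simp: sets_restrict_space_iff)
    show "integrable (lebesgue_on {0<..}) (\<lambda>\<tau>. \<bar>indicator {0<..T} \<tau> * q \<tau>\<bar>)"
      using q[OF T(1)] by (rule integrable_abs)
    show "AE \<tau> in lebesgue_on {0<..}. norm (indicator {0<..<T} \<tau> * (\<psi> n \<tau> * q \<tau>)) \<le> \<bar>indicator {0<..T} \<tau> * q \<tau>\<bar>" for n
    proof (rule AE_I2)
      fix \<tau>
      have "\<bar>\<psi> n \<tau>\<bar> \<le> 1"
        using smooth_step_bounds[of "real (Suc n) * (\<tau> - s)"] smooth_step_bounds[of "real (Suc n) * (\<tau> - t)"]
        unfolding \<psi>_def by linarith
      then have "\<bar>\<psi> n \<tau>\<bar> * \<bar>q \<tau>\<bar> \<le> 1 * \<bar>q \<tau>\<bar>" by (rule mult_right_mono) simp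
      then show "norm (indicator {0<..<T} \<tau> * (\<psi> n \<tau> * q \<tau>)) \<le> \<bar>indicator {0<..T} \<tau> * q \<tau>\<bar>"
        by (simp add: abs_mult indicator_def)
    qed
    show "AE \<tau> in lebesgue_on {0<..}. (\<lambda>n. indicator {0<..<T} \<tau> * (\<psi> n \<tau> * q \<tau>)) \<longlonglongrightarrow> indicator {s<..t} \<tau> * q \<tau>"
    proof (rule AE_I2)
      fix \<tau> :: real assume "\<tau> \<in> space (lebesgue_on {0<..})"
      have lim: "(\<lambda>n. smooth_step (real (Suc n) * (\<tau> - r))) \<longlonglongrightarrow> indicator {r<..} \<tau>" for r
      proof (cases "\<tau> \<le> r")
        case True
        then have "real (Suc n) * (\<tau> - r) \<le> 0" for n by (auto simp: mult_le_0_iff)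
        then have "smooth_step (real (Suc n) * (\<tau> - r)) = 0" for n by (rule smooth_step_0)
        then show ?thesis using True by (simp only:) (simp add: indicator_def)
      next
        case False
        then obtain m where m: "1 / (\<tau> - r) < real m" using reals_Archimedean2 by blast
        have "smooth_step (real (Suc n) * (\<tau> - r)) = 1" if "n \<ge> m" for n
        proof (rule smooth_step_1)
          have "1 / (\<tau> - r) \<le> real (Suc n)" using m that by simp
          then show "1 \<le> real (Suc n) * (\<tau> - r)" using False by (simp add: field_simps)
        qed
        then have "\<forall>\<^sub>F n in sequentially. smooth_step (real (Suc n) * (\<tau> - r)) = 1"
          unfolding eventually_sequentially by blast
        then show ?thesis using False by (intro tendsto_eventually) (simp add: indicator_def)
      qed
      have "(\<lambda>n. \<psi> n \<tau>) \<longlonglongrightarrow> indicator {s<..} \<tau> - indicator {t<..} \<tau>"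
        unfolding \<psi>_def by (intro tendsto_diff lim)
      then have "(\<lambda>n. indicator {0<..<T} \<tau> * (\<psi> n \<tau> * q \<tau>)) \<longlonglongrightarrow> indicator {0<..<T} \<tau> * ((indicator {s<..} \<tau> - indicator {t<..} \<tau>) * q \<tau>)"
        by (intro tendsto_intros)
      moreover have "indicator {0<..<T} \<tau> * ((indicator {s<..} \<tau> - indicator {t<..} \<tau>) * q \<tau>)
          = indicator {s<..t} \<tau> * q \<tau>"
        using st by (auto simp: indicator_def T_def)
      ultimately show "(\<lambda>n. indicator {0<..<T} \<tau> * (\<psi> n \<tau> * q \<tau>)) \<longlonglongrightarrow> indicator {s<..t} \<tau> * q \<tau>"
        by simp
    qed
  qed
  ultimately have "c s - c t = (\<integral>\<tau>. indicator {s<..t} \<tau> * q \<tau> \<partial>lebesgue_on {0<..})"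
    unfolding weak[OF T(1) test] by (rule LIMSEQ_unique)
  then show ?thesis by simp
qed


section \<open>A decay estimate over dyadic times\<close>

text \<open>Here \<open>f\<close> stands for the squared distance to equilibrium, \<open>\<kappa>\<close> for the squared norm of the gradient, and
  \<open>K\<close>, \<open>G\<close> for time integrals of the dissipation. No bound on \<open>f\<close> at the time \<open>t\<close> itself is available from
  \<open>\<kappa> t\<close>, since \<open>t\<close> may be an exceptional time; therefore \<open>t\<close> is approached through good times \<open>\<tau> j\<close>. The
  length of the step from \<open>\<tau> (j + 1)\<close> to \<open>\<tau> j\<close> is comparable to the length of the intervals on which
  \<open>\<kappa> (\<tau> j)\<close> and \<open>\<kappa> (\<tau> (j + 1))\<close> lie below a mean, so each product of the two is bounded by an increment
  of \<open>K\<close>, and the increments telescope.\<close>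

lemma dyadic_decay:
  fixes f \<kappa> K G :: "real \<Rightarrow> real"
  assumes K: "mono K" and G: "mono G" and \<kappa>: "\<And>\<tau>. \<kappa> \<tau> \<ge> 0"
    and good: "\<And>a b. t \<le> a \<Longrightarrow> a < b \<Longrightarrow> \<exists>\<tau>. a < \<tau> \<and> \<tau> < b \<and> P \<tau> \<and> \<kappa> \<tau> * (b - a) \<le> K b - K a"
    and increment: "\<And>r s. P r \<Longrightarrow> P s \<Longrightarrow> r < s \<Longrightarrow> \<bar>f s - f r\<bar> \<le> G s - G r + (s - r) * (\<kappa> r + \<kappa> s) / 2"
    and upper: "\<And>\<tau>. P \<tau> \<Longrightarrow> f \<tau> \<le> \<kappa> \<tau>"
    and cont: "(f \<longlongrightarrow> f t) (at_right t)"
  shows "f t \<le> G (t + 1) - G t + 5 * (K (t + 1) - K t)"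
proof -
  define h :: "nat \<Rightarrow> real" where "h j = (1 / 2) ^ j" for j
  have h: "h j > 0" "h (Suc j) = h j / 2" for j by (simp_all add: h_def)
  have h0: "h 0 = 1" "h 1 = 1 / 2" by (simp_all add: h_def)
  have h_lim: "h \<longlonglongrightarrow> 0" unfolding h_def[abs_def] by (rule LIMSEQ_power_zero) simp
  have "\<exists>\<tau>. t + h (Suc j) < \<tau> \<and> \<tau> < t + h j \<and> P \<tau> \<and> \<kappa> \<tau> * h (Suc j) \<le> K (t + h j) - K (t + h (Suc j))" for j
    using good[of "t + h (Suc j)" "t + h j"] h(1)[of j] by (simp add: h(2))
  then obtain \<tau> where \<tau>: "\<And>j. t + h (Suc j) < \<tau> j" "\<And>j. \<tau> j < t + h j" "\<And>j. P (\<tau> j)"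
    and \<kappa>\<tau>: "\<And>j. \<kappa> (\<tau> j) * h (Suc j) \<le> K (t + h j) - K (t + h (Suc j))"
    by metis
  have step: "f (\<tau> (Suc j)) - f (\<tau> j) \<le> (G (\<tau> j) - G (\<tau> (Suc j)))
      + (K (t + h j) - K (t + h (Suc j))) + 2 * (K (t + h (Suc j)) - K (t + h (Suc (Suc j))))" for j
  proof -
    have less: "\<tau> (Suc j) < \<tau> j" using \<tau>(1)[of j] \<tau>(2)[of "Suc j"] by linarith
    have "\<tau> j - \<tau> (Suc j) \<le> h j" using \<tau>(2)[of j] \<tau>(1)[of "Suc j"] h(1)[of "Suc (Suc j)"] by linarith
    then have "(\<tau> j - \<tau> (Suc j)) * (\<kappa> (\<tau> (Suc j)) + \<kappa> (\<tau> j)) \<le> h j * (\<kappa> (\<tau> (Suc j)) + \<kappa> (\<tau> j))"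
      by (intro mult_right_mono) (simp_all add: \<kappa>)
    also have "\<dots> = 4 * (\<kappa> (\<tau> (Suc j)) * h (Suc (Suc j))) + 2 * (\<kappa> (\<tau> j) * h (Suc j))"
      by (simp add: h(2) algebra_simps)
    also have "\<dots> \<le> 4 * (K (t + h (Suc j)) - K (t + h (Suc (Suc j)))) + 2 * (K (t + h j) - K (t + h (Suc j)))"
      by (intro add_mono mult_left_mono \<kappa>\<tau>) simp_all
    finally have A: "(\<tau> j - \<tau> (Suc j)) * (\<kappa> (\<tau> (Suc j)) + \<kappa> (\<tau> j)) \<le> \<dots>" .
    have "x' - x \<le> g + k1 + 2 * k2" if "\<bar>x - x'\<bar> \<le> g + a / 2" "a \<le> 4 * k2 + 2 * k1"
      for x x' g a k1 k2 :: real using that by linarith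
    from this[OF increment[OF \<tau>(3) \<tau>(3) less] A] show ?thesis .
  qed
  have tele: "f (\<tau> n) - f (\<tau> 0) \<le> (G (\<tau> 0) - G (\<tau> n)) + (K (t + h 0) - K (t + h n))
      + 2 * (K (t + h 1) - K (t + h (Suc n)))" for n
  proof (induction n)
    case (Suc n)
    then show ?case using step[of n] by argo
  qed simp
  have bound: "f (\<tau> n) \<le> G (t + 1) - G t + 5 * (K (t + 1) - K t)" for n
  proof -
    have "\<tau> n \<ge> t" using \<tau>(1)[of n] h(1)[of "Suc n"] by linarith
    then have "G (\<tau> 0) - G (\<tau> n) \<le> G (t + 1) - G t"
      using monoD[OF G, of "\<tau> 0" "t + 1"] monoD[OF G, of t "\<tau> n"] \<tau>(2)[of 0] h0 by linarith
    moreover have "K t \<le> K (t + h j)" "K (t + h j) \<le> K (t + 1)" for j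
      using h(1)[of j] by (auto intro!: monoD[OF K] simp: h_def power_le_one)
    moreover have "f (\<tau> 0) \<le> 2 * (K (t + h 0) - K (t + h 1))"
      using \<kappa>\<tau>[of 0] upper[OF \<tau>(3)[of 0]] by (simp add: h_def)
    ultimately show ?thesis using tele[of n] unfolding h0 by (smt (verit))
  qed
  have "filterlim \<tau> (at_right t) sequentially"
    unfolding filterlim_at
  proof (intro conjI)
    have "(\<lambda>j. t + h j) \<longlonglongrightarrow> t + 0" by (intro tendsto_intros h_lim)
    moreover have "\<forall>\<^sub>F j in sequentially. t \<le> \<tau> j"
      using \<tau>(1) h(1) by (intro always_eventually allI) (smt (verit))
    moreover have "\<forall>\<^sub>F j in sequentially. \<tau> j \<le> t + h j"
      using \<tau>(2) by (intro always_eventually allI less_imp_le)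
    ultimately show "\<tau> \<longlonglongrightarrow> t" using tendsto_sandwich[of "\<lambda>_. t" \<tau> sequentially "\<lambda>j. t + h j" t] by simp
    show "\<forall>\<^sub>F j in sequentially. \<tau> j \<in> {t<..} \<and> \<tau> j \<noteq> t"
      using \<tau>(1) h(1) by (intro always_eventually allI) (smt (verit) greaterThan_iff)
  qed
  then have "(\<lambda>n. f (\<tau> n)) \<longlonglongrightarrow> f t" by (rule filterlim_compose[OF cont])
  then show ?thesis by (rule LIMSEQ_le_const2) (use bound in blast)
qed


section \<open>Integrals over time\<close>

abbreviation time :: "real measure" where
  "time \<equiv> lebesgue_on {0<..}"

interpretation time: complete_measure time
  by (rule complete_measure_lebesgue_on) simp

lemma time_interval_sets: "0 \<le> a \<Longrightarrow> {a<..b} \<in> sets time"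
  by (auto simp: sets_restrict_space_iff)

lemma emeasure_time_interval: "0 \<le> a \<Longrightarrow> a \<le> b \<Longrightarrow> emeasure time {a<..b} = ennreal (b - a)"
  by (subst emeasure_restrict_space) auto

lemma integrable_time_indicator: "0 \<le> a \<Longrightarrow> a \<le> b \<Longrightarrow> integrable time (indicator {a<..b} :: real \<Rightarrow> real)"
  by (rule integrable_real_indicator) (auto simp: time_interval_sets emeasure_time_interval)

lemma integral_time_indicator:
  assumes "0 \<le> a" "a \<le> b"
  shows "(\<integral>\<tau>. indicator {a<..b} \<tau> \<partial>time) = b - a"
proof -
  have "{a<..b} \<inter> space time = {a<..b}" using assms by auto
  then show ?thesis using assms by (simp add: measure_def emeasure_time_interval)
qed

definition cumulative :: "(real \<Rightarrow> real) \<Rightarrow> real \<Rightarrow> real" where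
  "cumulative \<kappa> x = (\<integral>\<tau>. indicator {0<..x} \<tau> * \<kappa> \<tau> \<partial>time)"

lemma integrable_time_indicator_mult:
  fixes \<kappa> :: "real \<Rightarrow> real"
  assumes "integrable time \<kappa>" "0 \<le> a"
  shows "integrable time (\<lambda>\<tau>. indicator {a<..b} \<tau> * \<kappa> \<tau>)"
  using integrable_mult_indicator[OF time_interval_sets[OF assms(2)] assms(1), of b] by simp

lemma cumulative_diff:
  assumes "integrable time \<kappa>" "0 \<le> a" "a \<le> b"
  shows "cumulative \<kappa> b - cumulative \<kappa> a = (\<integral>\<tau>. indicator {a<..b} \<tau> * \<kappa> \<tau> \<partial>time)"
proof -
  have "cumulative \<kappa> b - cumulative \<kappa> a
      = (\<integral>\<tau>. indicator {0<..b} \<tau> * \<kappa> \<tau> - indicator {0<..a} \<tau> * \<kappa> \<tau> \<partial>time)"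
    unfolding cumulative_def
    by (rule Bochner_Integration.integral_diff[symmetric]) (auto intro!: integrable_time_indicator_mult assms)
  also have "\<dots> = (\<integral>\<tau>. indicator {a<..b} \<tau> * \<kappa> \<tau> \<partial>time)"
    by (rule Bochner_Integration.integral_cong) (use assms in \<open>auto simp: indicator_def\<close>)
  finally show ?thesis .
qed

lemma cumulative_mono:
  assumes "integrable time \<kappa>" "\<And>\<tau>. 0 \<le> \<kappa> \<tau>"
  shows "mono (cumulative \<kappa>)"
  unfolding cumulative_def
proof (rule monoI, rule integral_mono)
  fix x y \<tau> :: real assume "x \<le> y"
  then show "indicator {0<..x} \<tau> * \<kappa> \<tau> \<le> indicator {0<..y} \<tau> * \<kappa> \<tau>"
    using assms(2)[of \<tau>] by (simp add: indicator_def)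
qed (use assms(1) in \<open>auto intro: integrable_time_indicator_mult\<close>)

lemma cumulative_increment_tendsto_0:
  assumes \<kappa>: "integrable time \<kappa>"
  shows "((\<lambda>t. cumulative \<kappa> (t + 1) - cumulative \<kappa> t) \<longlongrightarrow> 0) at_top"
proof -
  have lim: "(cumulative \<kappa> \<longlongrightarrow> (\<integral>\<tau>. \<kappa> \<tau> \<partial>time)) at_top"
    unfolding cumulative_def
  proof (rule integral_dominated_convergence_at_top)
    show "integrable time (\<lambda>\<tau>. \<bar>\<kappa> \<tau>\<bar>)" using \<kappa> by (rule integrable_abs)
    show "\<kappa> \<in> borel_measurable time" using \<kappa> by (rule borel_measurable_integrable)
    show "(\<lambda>\<tau>. indicator {0<..x} \<tau> * \<kappa> \<tau>) \<in> borel_measurable time" for x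
      using integrable_time_indicator_mult[OF \<kappa>] by (intro borel_measurable_integrable) simp
    show "AE \<tau> in time. ((\<lambda>x. indicator {0<..x} \<tau> * \<kappa> \<tau>) \<longlongrightarrow> \<kappa> \<tau>) at_top"
    proof (rule AE_I2)
      fix \<tau> :: real assume "\<tau> \<in> space time"
      then have "\<forall>\<^sub>F x in at_top. indicator {0<..x} \<tau> * \<kappa> \<tau> = \<kappa> \<tau>"
        by (intro eventually_mono[OF eventually_ge_at_top[of \<tau>]]) simp
      then show "((\<lambda>x. indicator {0<..x} \<tau> * \<kappa> \<tau>) \<longlongrightarrow> \<kappa> \<tau>) at_top" by (rule tendsto_eventually)
    qed
    show "\<forall>\<^sub>F x in at_top. AE \<tau> in time. norm (indicator {0<..x} \<tau> * \<kappa> \<tau>) \<le> \<bar>\<kappa> \<tau>\<bar>"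
      by (intro always_eventually allI AE_I2) (simp add: indicator_def)
  qed
  have "((\<lambda>t. cumulative \<kappa> (t + 1)) \<longlongrightarrow> (\<integral>\<tau>. \<kappa> \<tau> \<partial>time)) at_top"
    by (rule filterlim_compose[OF lim], subst add.commute)
       (rule filterlim_tendsto_add_at_top[OF tendsto_const filterlim_ident])
  from tendsto_diff[OF this lim] show ?thesis by simp
qed

text \<open>Otherwise \<open>\<kappa>\<close> would exceed its mean almost everywhere on the interval.\<close>

lemma exists_below_mean:
  assumes \<kappa>: "integrable time \<kappa>" and P: "AE \<tau> in time. P \<tau>" and ab: "0 \<le> a" "a < b"
  shows "\<exists>\<tau>. a < \<tau> \<and> \<tau> < b \<and> P \<tau> \<and> \<kappa> \<tau> * (b - a) \<le> cumulative \<kappa> b - cumulative \<kappa> a"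
proof (rule ccontr)
  assume none: "\<not> ?thesis"
  define D where "D = (cumulative \<kappa> b - cumulative \<kappa> a) / (b - a)"
  have D: "D * (b - a) = cumulative \<kappa> b - cumulative \<kappa> a" using ab by (simp add: D_def)
  let ?g = "\<lambda>\<tau>. indicator {a<..b} \<tau> * \<kappa> \<tau> - D * indicator {a<..b} \<tau>"
  have "AE \<tau> in time. \<tau> \<noteq> b"
  proof -
    have "AE \<tau> in lebesgue. \<tau> \<noteq> b" by (rule AE_completion[OF AE_lborel_singleton])
    then have "AE \<tau> in lebesgue. \<tau> \<in> {0<..} \<longrightarrow> \<tau> \<noteq> b" by eventually_elim simp
    then show ?thesis by (subst AE_restrict_space_iff) auto
  qed
  then have gt: "AE \<tau> in time. \<tau> \<in> {a<..b} \<longrightarrow> D < \<kappa> \<tau>"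
    using P
  proof eventually_elim
    case (elim \<tau>)
    show ?case
    proof
      assume "\<tau> \<in> {a<..b}"
      then have "D * (b - a) < \<kappa> \<tau> * (b - a)" using none elim unfolding D by auto
      then show "D < \<kappa> \<tau>" using ab by simp
    qed
  qed
  have int1: "integrable time (\<lambda>\<tau>. indicator {a<..b} \<tau> * \<kappa> \<tau>)"
    by (rule integrable_time_indicator_mult[OF \<kappa> ab(1)])
  have int2: "integrable time (\<lambda>\<tau>. D * indicator {a<..b} \<tau>)"
    using integrable_time_indicator[of a b] ab by (intro integrable_mult_right) simp
  have nonneg: "AE \<tau> in time. 0 \<le> ?g \<tau>"
    using gt by eventually_elim (auto simp: indicator_def)
  have "(\<integral>\<tau>. ?g \<tau> \<partial>time) = cumulative \<kappa> b - cumulative \<kappa> a - D * (b - a)"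
    using ab by (simp only: Bochner_Integration.integral_diff[OF int1 int2] integral_mult_right_zero
        cumulative_diff[OF \<kappa> ab(1) less_imp_le] integral_time_indicator less_imp_le)
  then have "(\<integral>\<tau>. ?g \<tau> \<partial>time) = 0" by (simp add: D)
  then have "AE \<tau> in time. ?g \<tau> = 0"
    using integral_nonneg_eq_0_iff_AE[OF Bochner_Integration.integrable_diff[OF int1 int2] nonneg] by blast
  then have "AE \<tau> in time. \<tau> \<notin> {a<..b}" using gt by eventually_elim (auto simp: indicator_def)
  then have "emeasure time {\<tau> \<in> space time. \<tau> \<in> {a<..b}} = 0"
    by (rule emeasure_eq_0_AE)
  moreover have "{\<tau> \<in> space time. \<tau> \<in> {a<..b}} = {a<..b}" using ab by auto
  ultimately show False using ab by (simp add: emeasure_time_interval)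
qed


section \<open>Testing the weak equation\<close>

lemma test_function_continuous: "test_function T \<psi> \<Longrightarrow> continuous_on S \<psi>"
  unfolding test_function_def smooth_def using C_k.simps(1) continuous_on_subset by blast

text \<open>Approximating \<open>\<psi>\<close> by simple functions of time approximates \<open>\<psi> t * \<eta> x\<close> in \<open>H1\<close>.\<close>

lemma Bochner_L2_separated:
  assumes \<psi>: "test_function T \<psi>" and \<eta>: "\<eta> \<in> H1"
  shows "(\<lambda>t x. \<psi> t * \<eta> x) \<in> Bochner_L2 {0<..<T} H1 norm_H1"
proof -
  let ?M = "lebesgue_on {0<..<T}"
  have "\<psi> \<in> borel_measurable ?M"
    by (rule continuous_imp_measurable_on_sets_lebesgue[OF test_function_continuous[OF \<psi>]]) simp
  then obtain F where F: "\<And>n. simple_function ?M (F n)"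
    "\<And>t. t \<in> space ?M \<Longrightarrow> (\<lambda>n. F n t) \<longlonglongrightarrow> \<psi> t"
    using borel_measurable_implies_sequence_metric[of \<psi> ?M 0] by blast
  have "strongly_measurable {0<..<T} H1 norm_H1 (\<lambda>t x. \<psi> t * \<eta> x)"
    unfolding strongly_measurable_def
  proof (intro conjI exI[of _ "\<lambda>n t x. F n t * \<eta> x"] allI ballI)
    show "simple_function ?M (\<lambda>t x. F n t * \<eta> x)" for n
      by (rule simple_function_compose1[OF F(1)])
    show "AE t in ?M. (\<lambda>n. norm_H1 (\<lambda>x. F n t * \<eta> x - \<psi> t * \<eta> x)) \<longlonglongrightarrow> 0"
    proof (rule AE_I2)
      fix t assume t: "t \<in> space ?M"
      have "(\<lambda>n. \<bar>F n t - \<psi> t\<bar> * norm_H1 \<eta>) \<longlonglongrightarrow> \<bar>\<psi> t - \<psi> t\<bar> * norm_H1 \<eta>"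
        by (intro tendsto_intros F(2) t)
      then show "(\<lambda>n. norm_H1 (\<lambda>x. F n t * \<eta> x - \<psi> t * \<eta> x)) \<longlonglongrightarrow> 0"
        by (simp add: left_diff_distrib[symmetric] norm_H1_scale[OF \<eta>])
    qed
  qed (use wgrad_scale(1)[OF \<eta>] in auto)
  moreover have "integrable ?M (\<lambda>t. (norm_H1 (\<lambda>x. \<psi> t * \<eta> x))\<^sup>2)"
  proof -
    have "continuous_on {0..T} (\<lambda>t. (\<bar>\<psi> t\<bar> * norm_H1 \<eta>)\<^sup>2)"
      by (intro continuous_intros test_function_continuous[OF \<psi>])
    then show ?thesis unfolding norm_H1_scale[OF \<eta>]
      by (intro absolutely_integrable_imp_integrable[OF set_integrable_subset[OF absolutely_integrable_continuous_real]]) auto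
  qed
  ultimately show ?thesis by (simp add: Bochner_L2_def)
qed

text \<open>With the test function \<open>\<psi> t * \<eta> x\<close> the functional \<open>\<xi>\<close> appears in the same way in the weak equation and
  in the definition of the time derivative, and can be eliminated.\<close>

lemma weak_equation_separated:
  assumes eq: "weak_equation u w u0" and T: "T > 0" and \<psi>: "test_function T \<psi>" and \<eta>: "\<eta> \<in> H1"
  shows "(\<integral>t. deriv \<psi> t * (\<integral>x. u t x * \<eta> x \<partial>torus) \<partial>lebesgue_on {0<..<T})
       = (\<integral>t. \<psi> t * (\<integral>x. wgrad (w t) x \<bullet> wgrad \<eta> x \<partial>torus) \<partial>lebesgue_on {0<..<T})"
proof -
  let ?M = "lebesgue_on {0<..<T}"
  interpret M: complete_measure ?M by (rule complete_measure_lebesgue_on) simp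
  obtain \<xi> where \<xi>: "\<xi> \<in> Bochner_L2 {0<..<T} H1_dual norm_H1_dual"
    and time: "is_weak_time_derivative T u \<xi>"
    and weak: "\<And>\<phi>. \<phi> \<in> Bochner_L2 {0<..<T} H1 norm_H1 \<Longrightarrow>
       (\<integral>t. \<xi> t (\<phi> t) \<partial>?M) + (\<integral>t. (\<integral>x. wgrad (w t) x \<bullet> wgrad (\<phi> t) x \<partial>torus) \<partial>?M) = 0"
    using eq T unfolding weak_equation_def by blast
  have "(\<integral>t. deriv \<psi> t * (\<integral>x. u t x * \<eta> x \<partial>torus) \<partial>?M) = - (\<integral>t. \<psi> t * \<xi> t \<eta> \<partial>?M)"
    using time \<psi> \<eta> unfolding is_weak_time_derivative_def by blast
  also have "(\<integral>t. \<psi> t * \<xi> t \<eta> \<partial>?M) = (\<integral>t. \<xi> t (\<lambda>x. \<psi> t * \<eta> x) \<partial>?M)"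
  proof (rule M.integral_cong_AE')
    have "AE t in ?M. \<xi> t \<in> H1_dual"
      using \<xi> by (simp add: Bochner_L2_def strongly_measurable_def)
    then show "AE t in ?M. \<psi> t * \<xi> t \<eta> = \<xi> t (\<lambda>x. \<psi> t * \<eta> x)"
    proof eventually_elim
      fix t assume "\<xi> t \<in> H1_dual"
      \<comment> \<open>Linearity is given for two summands; the second coefficient is taken to be \<open>0\<close>.\<close>
      then have "\<xi> t (\<lambda>x. \<psi> t * \<eta> x + 0 * \<eta> x) = \<psi> t * \<xi> t \<eta> + 0 * \<xi> t \<eta>"
        using \<eta> unfolding H1_dual_def by blast
      then show "\<psi> t * \<xi> t \<eta> = \<xi> t (\<lambda>x. \<psi> t * \<eta> x)" by simp
    qed
  qed
  also have "- \<dots> = (\<integral>t. (\<integral>x. wgrad (w t) x \<bullet> wgrad (\<lambda>x. \<psi> t * \<eta> x) x \<partial>torus) \<partial>?M)"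
    using weak[OF Bochner_L2_separated[OF \<psi> \<eta>]] by simp
  also have "\<dots> = (\<integral>t. \<psi> t * (\<integral>x. wgrad (w t) x \<bullet> wgrad \<eta> x \<partial>torus) \<partial>?M)"
  proof (rule Bochner_Integration.integral_cong[OF refl])
    fix t
    have "(\<integral>x. wgrad (w t) x \<bullet> wgrad (\<lambda>x. \<psi> t * \<eta> x) x \<partial>torus)
        = (\<integral>x. \<psi> t * (wgrad (w t) x \<bullet> wgrad \<eta> x) \<partial>torus)"
    proof (rule torus.integral_cong_AE')
      show "AE x in torus. wgrad (w t) x \<bullet> wgrad (\<lambda>x. \<psi> t * \<eta> x) x = \<psi> t * (wgrad (w t) x \<bullet> wgrad \<eta> x)"
        using wgrad_scale(2)[OF \<eta>, of "\<psi> t"] by eventually_elim simp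
    qed
    then show "(\<integral>x. wgrad (w t) x \<bullet> wgrad (\<lambda>x. \<psi> t * \<eta> x) x \<partial>torus)
        = \<psi> t * (\<integral>x. wgrad (w t) x \<bullet> wgrad \<eta> x \<partial>torus)" by simp
  qed
  finally show ?thesis .
qed

lemma strongly_measurable_inner:
  assumes G: "strongly_measurable {0<..} L2 norm_L2 G" and h: "h \<in> L2"
  shows "(\<lambda>t. \<integral>x. G t x \<bullet> h x \<partial>torus) \<in> borel_measurable time"
proof -
  obtain s where s: "\<And>n :: nat. simple_function time (s n)" "\<And>n t. t \<in> {0<..} \<Longrightarrow> s n t \<in> L2"
    and lim: "AE t in time. (\<lambda>n. norm_L2 (\<lambda>x. s n t x - G t x)) \<longlonglongrightarrow> 0"
    using G unfolding strongly_measurable_def by blast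
  have GL: "AE t in time. G t \<in> L2" using G by (simp add: strongly_measurable_def)
  have pos: "AE t in time. t \<in> {0<..}" by (rule AE_I2) simp
  show ?thesis
  proof (rule time.borel_measurable_AE_limit)
    show "(\<lambda>t. \<integral>x. s n t x \<bullet> h x \<partial>torus) \<in> borel_measurable time" for n
      by (intro borel_measurable_simple_function simple_function_compose1[OF s(1)])
    show "AE t in time. (\<lambda>n. \<integral>x. s n t x \<bullet> h x \<partial>torus) \<longlonglongrightarrow> (\<integral>x. G t x \<bullet> h x \<partial>torus)"
      using lim GL pos
    proof eventually_elim
      case (elim t)
      have "(\<lambda>n. (\<integral>x. s n t x \<bullet> h x \<partial>torus) - (\<integral>x. G t x \<bullet> h x \<partial>torus)) \<longlonglongrightarrow> 0"
      proof (rule Lim_null_comparison)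
        show "(\<lambda>n. norm_L2 (\<lambda>x. s n t x - G t x) * norm_L2 h) \<longlonglongrightarrow> 0"
          using elim(1) by (rule tendsto_mult_left_zero)
        show "\<forall>\<^sub>F n in sequentially. norm ((\<integral>x. s n t x \<bullet> h x \<partial>torus) - (\<integral>x. G t x \<bullet> h x \<partial>torus))
            \<le> norm_L2 (\<lambda>x. s n t x - G t x) * norm_L2 h"
        proof (intro always_eventually allI)
          fix n
          have snL: "s n t \<in> L2" by (rule s(2)[OF elim(3)])
          show "norm ((\<integral>x. s n t x \<bullet> h x \<partial>torus) - (\<integral>x. G t x \<bullet> h x \<partial>torus))
              \<le> norm_L2 (\<lambda>x. s n t x - G t x) * norm_L2 h"
            using L2_Cauchy_Schwarz[OF L2_diff[OF snL elim(2)] h]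
            by (simp add: inner_diff_left L2_inner_integrable snL elim(2) h)
        qed
      qed
      then show ?case by (rule LIM_zero_cancel)
    qed
  qed
qed


section \<open>Long-time behaviour of weak solutions\<close>

text \<open>Only \<open>v\<close> is meaningful at every time. It coincides with \<open>u\<close>, which is weakly differentiable in space,
  at almost every time.\<close>

locale weak_flow =
  fixes u w :: "real \<Rightarrow> real ^ 'n \<Rightarrow> real" and u0 :: "real ^ 'n \<Rightarrow> real" and v :: "real \<Rightarrow> real ^ 'n \<Rightarrow> real"
  assumes eq: "weak_equation u w u0" and v: "continuous_representative u v"
begin

definition flux :: "(real ^ 'n \<Rightarrow> real) \<Rightarrow> real \<Rightarrow> real" where
  "flux \<eta> t = (\<integral>x. wgrad (w t) x \<bullet> wgrad \<eta> x \<partial>torus)"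

definition dissipation_u :: "real \<Rightarrow> real" where
  "dissipation_u t = (norm_L2 (wgrad (u t)))\<^sup>2"

definition dissipation_w :: "real \<Rightarrow> real" where
  "dissipation_w t = (norm_L2 (wgrad (w t)))\<^sup>2"

definition regular :: "real \<Rightarrow> bool" where
  "regular t \<longleftrightarrow> t > 0 \<and> u t \<in> H1 \<and> (AE x in torus. v t x = u t x)"

lemma regularity:
  "AE t in time. u t \<in> H1" "AE t in time. w t \<in> H1"
  "(\<lambda>t. wgrad (u t)) \<in> Bochner_L2 {0<..} L2 norm_L2"
  "(\<lambda>t. wgrad (w t)) \<in> Bochner_L2 {0<..} L2 norm_L2"
  using eq unfolding weak_equation_def by blast+

lemma dissipation_integrable: "integrable time dissipation_u" "integrable time dissipation_w"
  using regularity(3,4) by (auto simp: Bochner_L2_def dissipation_u_def[abs_def] dissipation_w_def[abs_def])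

lemma dissipation_nonneg: "0 \<le> dissipation_u t" "0 \<le> dissipation_w t"
  by (simp_all add: dissipation_u_def dissipation_w_def)

lemma v_L2: "t \<ge> 0 \<Longrightarrow> v t \<in> L2"
  and v_continuous: "t \<ge> 0 \<Longrightarrow> ((\<lambda>s. norm_L2 (\<lambda>x. v s x - v t x)) \<longlongrightarrow> 0) (at t within {0..})"
  and v_eq_u: "AE t in time. AE x in torus. v t x = u t x"
  using v unfolding continuous_representative_def by auto

lemma AE_regular: "AE t in time. regular t"
proof -
  have "AE t in time. t > 0" by (rule AE_I2) simp
  with regularity(1) v_eq_u show ?thesis by eventually_elim (simp add: regular_def)
qed

lemma flux_measurable: "\<eta> \<in> H1 \<Longrightarrow> flux \<eta> \<in> borel_measurable time"
  unfolding flux_def[abs_def]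
  using regularity(4) by (intro strongly_measurable_inner wgrad(1)) (auto simp: Bochner_L2_def)

text \<open>The product of norms is split by Young's inequality, since its two factors are integrated in different
  ways: \<open>dissipation_w\<close> over time, and the gradient of \<open>\<eta>\<close> as a constant.\<close>

lemma flux_bound:
  assumes "\<eta> \<in> H1"
  shows "AE t in time. \<bar>flux \<eta> t\<bar> \<le> (dissipation_w t + (norm_L2 (wgrad \<eta>))\<^sup>2) / 2"
  using regularity(2)
proof eventually_elim
  case (elim t)
  have "\<bar>flux \<eta> t\<bar> \<le> norm_L2 (wgrad (w t)) * norm_L2 (wgrad \<eta>)"
    unfolding flux_def by (intro L2_Cauchy_Schwarz wgrad(1) elim assms)
  also have "\<dots> \<le> (dissipation_w t + (norm_L2 (wgrad \<eta>))\<^sup>2) / 2"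
    using sum_squares_bound[of "norm_L2 (wgrad (w t))" "norm_L2 (wgrad \<eta>)"]
    by (simp add: dissipation_w_def)
  finally show ?case .
qed

lemma flux_bound_integral:
  assumes \<eta>: "\<eta> \<in> H1" and ab: "0 \<le> a" "a \<le> b"
  shows "integrable time (\<lambda>t. indicator {a<..b} t * flux \<eta> t)"
    and "\<bar>\<integral>t. indicator {a<..b} t * flux \<eta> t \<partial>time\<bar>
      \<le> (cumulative dissipation_w b - cumulative dissipation_w a + (b - a) * (norm_L2 (wgrad \<eta>))\<^sup>2) / 2"
proof -
  define C where "C = (norm_L2 (wgrad \<eta>))\<^sup>2"
  let ?B = "\<lambda>t. (indicator {a<..b} t * dissipation_w t + indicator {a<..b} t * C) / 2"
  have i1: "integrable time (\<lambda>t. indicator {a<..b} t * dissipation_w t)"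
    by (rule integrable_time_indicator_mult[OF dissipation_integrable(2) ab(1)])
  have i2: "integrable time (\<lambda>t. indicator {a<..b} t * C)"
    by (intro integrable_mult_left integrable_time_indicator ab)
  have B: "integrable time ?B"
    by (intro integrable_divide Bochner_Integration.integrable_add i1 i2)
  have bound: "AE t in time. norm (indicator {a<..b} t * flux \<eta> t) \<le> ?B t"
    using flux_bound[OF \<eta>] by eventually_elim (simp add: indicator_def C_def)
  have meas: "(\<lambda>t. indicator {a<..b} t * flux \<eta> t) \<in> borel_measurable time"
    using time_interval_sets[OF ab(1)]
    by (intro borel_measurable_times borel_measurable_indicator flux_measurable \<eta>) auto
  show int: "integrable time (\<lambda>t. indicator {a<..b} t * flux \<eta> t)"
    by (rule Bochner_Integration.integrable_bound[OF B meas])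
       (use bound in \<open>eventually_elim, simp\<close>)
  have "\<bar>\<integral>t. indicator {a<..b} t * flux \<eta> t \<partial>time\<bar> \<le> (\<integral>t. ?B t \<partial>time)"
    by (rule order.trans[OF integral_abs_bound], rule integral_mono_AE)
       (use int B bound in \<open>simp_all only: integrable_abs real_norm_def\<close>)
  also have "\<dots> = (cumulative dissipation_w b - cumulative dissipation_w a + (b - a) * C) / 2"
    using i1 i2 by (simp only: integral_divide_zero Bochner_Integration.integral_add integral_mult_left_zero
        integral_time_indicator[OF ab] cumulative_diff[OF dissipation_integrable(2) ab])
  finally show "\<bar>\<integral>t. indicator {a<..b} t * flux \<eta> t \<partial>time\<bar>
      \<le> (cumulative dissipation_w b - cumulative dissipation_w a + (b - a) * (norm_L2 (wgrad \<eta>))\<^sup>2) / 2"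
    by (simp add: C_def)
qed

lemma inner_continuous:
  assumes \<eta>: "\<eta> \<in> L2" and t: "t \<ge> 0"
  shows "((\<lambda>s. \<integral>x. v s x * \<eta> x \<partial>torus) \<longlongrightarrow> (\<integral>x. v t x * \<eta> x \<partial>torus)) (at t within {0..})"
proof (rule LIM_zero_cancel, rule Lim_null_comparison)
  show "((\<lambda>s. norm_L2 (\<lambda>x. v s x - v t x) * norm_L2 \<eta>) \<longlongrightarrow> 0) (at t within {0..})"
    using v_continuous[OF t] by (rule tendsto_mult_left_zero)
  have "norm ((\<integral>x. v s x * \<eta> x \<partial>torus) - (\<integral>x. v t x * \<eta> x \<partial>torus)) \<le> norm_L2 (\<lambda>x. v s x - v t x) * norm_L2 \<eta>"
    if "s \<ge> 0" for s
    using L2_Cauchy_Schwarz[OF L2_diff[OF v_L2[OF that] v_L2[OF t]] \<eta>]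
      L2_inner_integrable[OF v_L2[OF that] \<eta>] L2_inner_integrable[OF v_L2[OF t] \<eta>]
    by (simp add: left_diff_distrib)
  then show "\<forall>\<^sub>F s in at t within {0..}. norm ((\<integral>x. v s x * \<eta> x \<partial>torus) - (\<integral>x. v t x * \<eta> x \<partial>torus))
      \<le> norm_L2 (\<lambda>x. v s x - v t x) * norm_L2 \<eta>"
    by (auto simp: eventually_at_filter)
qed

text \<open>Both sides of the separated equation see \<open>u\<close> only through integrals over time, so \<open>u\<close> may be replaced
  by \<open>v\<close>, whose inner product with \<open>\<eta>\<close> is continuous and hence has increments.\<close>

lemma increment:
  assumes \<eta>: "\<eta> \<in> H1" and st: "0 < s" "s < t"
  shows "(\<integral>x. v t x * \<eta> x \<partial>torus) - (\<integral>x. v s x * \<eta> x \<partial>torus)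
       = - (\<integral>\<tau>. indicator {s<..t} \<tau> * flux \<eta> \<tau> \<partial>time)"
proof (rule weak_derivative_increment[OF _ _ _ _ st])
  show "continuous_on {0..} (\<lambda>t. \<integral>x. v t x * \<eta> x \<partial>torus)"
    unfolding continuous_on_def using inner_continuous[OF H1_L2[OF \<eta>]] by simp
  show "flux \<eta> \<in> borel_measurable time" by (rule flux_measurable[OF \<eta>])
  show "integrable time (\<lambda>t. indicator {0<..T} t * flux \<eta> t)" if "T > 0" for T
    using flux_bound_integral(1)[OF \<eta>, of 0 T] that by simp
  fix T \<psi> assume T: "T > (0 :: real)" and \<psi>: "test_function T \<psi>"
  interpret M: complete_measure "lebesgue_on {0<..<T}" by (rule complete_measure_lebesgue_on) simp
  have "(\<integral>t. deriv \<psi> t * (\<integral>x. v t x * \<eta> x \<partial>torus) \<partial>lebesgue_on {0<..<T})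
      = (\<integral>t. deriv \<psi> t * (\<integral>x. u t x * \<eta> x \<partial>torus) \<partial>lebesgue_on {0<..<T})"
  proof (rule M.integral_cong_AE')
    have "AE t in lebesgue. t \<in> {0<..} \<longrightarrow> (AE x in torus. v t x = u t x)"
      using v_eq_u by (subst (asm) AE_restrict_space_iff) auto
    then have "AE t in lebesgue. t \<in> {0<..<T} \<longrightarrow> (AE x in torus. v t x = u t x)"
      by eventually_elim auto
    then have "AE t in lebesgue_on {0<..<T}. AE x in torus. v t x = u t x"
      by (subst AE_restrict_space_iff) auto
    then show "AE t in lebesgue_on {0<..<T}. deriv \<psi> t * (\<integral>x. v t x * \<eta> x \<partial>torus) = deriv \<psi> t * (\<integral>x. u t x * \<eta> x \<partial>torus)"
    proof eventually_elim
      case (elim t)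
      have "(\<integral>x. v t x * \<eta> x \<partial>torus) = (\<integral>x. u t x * \<eta> x \<partial>torus)"
        by (rule torus.integral_cong_AE') (use elim in \<open>eventually_elim, simp\<close>)
      then show ?case by simp
    qed
  qed
  also have "\<dots> = (\<integral>t. \<psi> t * flux \<eta> t \<partial>lebesgue_on {0<..<T})"
    unfolding flux_def by (rule weak_equation_separated[OF eq T \<psi> \<eta>])
  finally show "(\<integral>t. deriv \<psi> t * (\<integral>x. v t x * \<eta> x \<partial>torus) \<partial>lebesgue_on {0<..<T})
      = (\<integral>t. \<psi> t * flux \<eta> t \<partial>lebesgue_on {0<..<T})" .
qed

text \<open>The flux through the constant function \<open>1\<close> vanishes. This settles positive times; the time \<open>0\<close>
  follows by continuity.\<close>

lemma mean_conserved:
  assumes "t \<ge> 0"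
  shows "torus_mean (v t) = torus_mean (v 0)"
proof -
  have flux_1: "flux (\<lambda>x. 1) t = 0" for t
  proof -
    have "flux (\<lambda>x. 1) t = integral\<^sup>L torus (\<lambda>x :: real ^ 'n. 0)" unfolding flux_def
      by (rule torus.integral_cong_AE') (use wgrad_const(2)[of 1] in \<open>eventually_elim, simp\<close>)
    then show ?thesis by simp
  qed
  have pos: "torus_mean (v t) = torus_mean (v s)" if "0 < s" "s < t" for s t
    using increment[OF wgrad_const(1)[of 1] that] by (simp add: flux_1 torus_mean_eq)
  show ?thesis
  proof (cases "t = 0")
    case False
    then have t: "t > 0" using assms by simp
    have "((\<lambda>s. torus_mean (v s)) \<longlongrightarrow> torus_mean (v 0)) (at 0 within {0..})"
      using inner_continuous[OF L2_const[of 1], of 0] by (simp add: torus_mean_eq)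
    then have "((\<lambda>s. torus_mean (v s)) \<longlongrightarrow> torus_mean (v 0)) (at_right 0)"
      by (rule tendsto_within_subset) auto
    moreover have "((\<lambda>s. torus_mean (v s)) \<longlongrightarrow> torus_mean (v t)) (at_right 0)"
    proof (rule tendsto_eventually)
      have "\<forall>\<^sub>F s in at_right 0. 0 < s \<and> s < t"
        using t by (auto simp: eventually_at_right[OF t])
      then show "\<forall>\<^sub>F s in at_right 0. torus_mean (v s) = torus_mean (v t)"
        by eventually_elim (use pos in fastforce)
    qed
    ultimately show ?thesis using tendsto_unique[of "at_right (0 :: real)"] by simp
  qed simp
qed

text \<open>\<open>\<parallel>v(s)\<parallel>\<^sup>2 - \<parallel>v(r)\<parallel>\<^sup>2\<close> is the inner product of \<open>v(s) - v(r)\<close> with \<open>v(r) + v(s)\<close>. At regular times the second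
  factor is the admissible test function \<open>u(r) + u(s)\<close>.\<close>

lemma norm_square_increment:
  assumes r: "regular r" and s: "regular s" and rs: "r < s"
  shows "\<bar>(norm_L2 (v s))\<^sup>2 - (norm_L2 (v r))\<^sup>2\<bar>
    \<le> cumulative dissipation_w s - cumulative dissipation_w r + (s - r) * (dissipation_u r + dissipation_u s) / 2"
proof -
  have pos: "0 < r" "0 < s" and H: "u r \<in> H1" "u s \<in> H1"
    and ae: "AE x in torus. v r x = u r x" "AE x in torus. v s x = u s x"
    using r s by (auto simp: regular_def)
  have vL: "v r \<in> L2" "v s \<in> L2" using pos v_L2 by auto
  note uL = H[THEN H1_L2]
  have i: "integrable torus (\<lambda>x. v s x * u r x)" "integrable torus (\<lambda>x. v s x * u s x)"
    "integrable torus (\<lambda>x. v r x * u r x)" "integrable torus (\<lambda>x. v r x * u s x)"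
    using L2_inner_integrable[OF vL(2) uL(1)] L2_inner_integrable[OF vL(2) uL(2)]
      L2_inner_integrable[OF vL(1) uL(1)] L2_inner_integrable[OF vL(1) uL(2)] by simp_all
  have "(norm_L2 (v s))\<^sup>2 - (norm_L2 (v r))\<^sup>2 = (\<integral>x. (norm (v s x))\<^sup>2 - (norm (v r x))\<^sup>2 \<partial>torus)"
    unfolding norm_L2_square using vL by (simp add: L2_square_integrable del: real_norm_def)
  also have "\<dots> = (\<integral>x. (v s x * u r x - v r x * u r x) + (v s x * u s x - v r x * u s x) \<partial>torus)"
    by (rule torus.integral_cong_AE')
       (use ae in \<open>eventually_elim, simp add: power2_eq_square algebra_simps\<close>)
  also have "\<dots> = ((\<integral>x. v s x * u r x \<partial>torus) - (\<integral>x. v r x * u r x \<partial>torus))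
      + ((\<integral>x. v s x * u s x \<partial>torus) - (\<integral>x. v r x * u s x \<partial>torus))"
    using i by simp
  also have "\<dots> = - (\<integral>\<tau>. indicator {r<..s} \<tau> * flux (u r) \<tau> \<partial>time) + - (\<integral>\<tau>. indicator {r<..s} \<tau> * flux (u s) \<tau> \<partial>time)"
    by (simp only: increment[OF H(1) pos(1) rs] increment[OF H(2) pos(1) rs])
  finally have "\<bar>(norm_L2 (v s))\<^sup>2 - (norm_L2 (v r))\<^sup>2\<bar>
      \<le> \<bar>\<integral>\<tau>. indicator {r<..s} \<tau> * flux (u r) \<tau> \<partial>time\<bar> + \<bar>\<integral>\<tau>. indicator {r<..s} \<tau> * flux (u s) \<tau> \<partial>time\<bar>"
    by linarith
  also have "\<dots> \<le> (cumulative dissipation_w s - cumulative dissipation_w r + (s - r) * dissipation_u r) / 2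
      + (cumulative dissipation_w s - cumulative dissipation_w r + (s - r) * dissipation_u s) / 2"
    unfolding dissipation_u_def using pos rs
    by (intro add_mono flux_bound_integral(2) H) auto
  also have "\<dots> = cumulative dissipation_w s - cumulative dissipation_w r + (s - r) * (dissipation_u r + dissipation_u s) / 2"
    by (simp add: field_simps)
  finally show ?thesis .
qed

lemma norm_square_continuous:
  assumes t: "t \<ge> 0"
  shows "((\<lambda>s. (norm_L2 (v s))\<^sup>2) \<longlongrightarrow> (norm_L2 (v t))\<^sup>2) (at t within {0..})"
proof -
  have vt: "v t \<in> L2" by (rule v_L2[OF t])
  have self: "(\<integral>x. v t x * v t x \<partial>torus) = (norm_L2 (v t))\<^sup>2"
    unfolding norm_L2_square by (simp add: power2_eq_square)
  have expand: "(norm_L2 (v s))\<^sup>2 = (norm_L2 (\<lambda>x. v s x - v t x))\<^sup>2 + 2 * (\<integral>x. v s x * v t x \<partial>torus) - (norm_L2 (v t))\<^sup>2"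
    if "s \<ge> 0" for s
    using square_integrable_scaleR_diff(2)[of "v s" torus "v t" 1] v_L2[OF that] vt
    by (simp add: norm_L2_square L2_def)
  have "((\<lambda>s. (norm_L2 (\<lambda>x. v s x - v t x))\<^sup>2 + 2 * (\<integral>x. v s x * v t x \<partial>torus) - (norm_L2 (v t))\<^sup>2)
      \<longlongrightarrow> 0\<^sup>2 + 2 * (norm_L2 (v t))\<^sup>2 - (norm_L2 (v t))\<^sup>2) (at t within {0..})"
    unfolding self[symmetric] by (intro tendsto_intros v_continuous inner_continuous vt t)
  then have "((\<lambda>s. (norm_L2 (\<lambda>x. v s x - v t x))\<^sup>2 + 2 * (\<integral>x. v s x * v t x \<partial>torus) - (norm_L2 (v t))\<^sup>2)
      \<longlongrightarrow> (norm_L2 (v t))\<^sup>2) (at t within {0..})" by simp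
  then show ?thesis
    by (rule Lim_transform_eventually) (auto simp: eventually_at_filter expand)
qed

definition variance :: "real \<Rightarrow> real" where
  "variance t = (norm_L2 (\<lambda>x. v t x - torus_mean (v 0)))\<^sup>2"

lemma variance_eq:
  assumes "t \<ge> 0"
  shows "variance t = (norm_L2 (v t))\<^sup>2 - (torus_mean (v 0))\<^sup>2"
proof -
  define m where "m = torus_mean (v 0)"
  have "(\<integral>x. v t x \<partial>torus) = m" using mean_conserved[OF assms] by (simp add: torus_mean_eq m_def)
  then show ?thesis
    using square_integrable_scaleR_diff(2)[of "v t" torus "\<lambda>x. m" 1] v_L2[OF assms]
    unfolding variance_def m_def[symmetric] norm_L2_square by (simp add: L2_def power2_eq_square)
qed

lemma variance_le_dissipation:
  assumes "regular t"
  shows "variance t \<le> dissipation_u t"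
proof -
  have t: "t > 0" "u t \<in> H1" and ae: "AE x in torus. v t x = u t x"
    using assms by (auto simp: regular_def)
  have "torus_mean (u t) = torus_mean (v t)"
    unfolding torus_mean_eq by (rule torus.integral_cong_AE') (use ae in \<open>eventually_elim, simp\<close>)
  then have m: "torus_mean (u t) = torus_mean (v 0)" using mean_conserved[of t] t by simp
  have "variance t = (norm_L2 (\<lambda>x. u t x - torus_mean (u t)))\<^sup>2"
    unfolding variance_def m by (intro arg_cong[where f = "\<lambda>r. r\<^sup>2"] norm_L2_cong_AE)
       (use ae in \<open>eventually_elim, simp\<close>)
  also have "\<dots> \<le> dissipation_u t"
    unfolding dissipation_u_def by (intro Poincare_inequality H1_L2 wgrad t)
  finally show ?thesis .
qed

lemma variance_bound:
  assumes t: "t \<ge> 0"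
  shows "variance t \<le> (cumulative dissipation_w (t + 1) - cumulative dissipation_w t)
    + 5 * (cumulative dissipation_u (t + 1) - cumulative dissipation_u t)"
proof (rule dyadic_decay[where P = regular and \<kappa> = dissipation_u])
  show "mono (cumulative dissipation_u)" "mono (cumulative dissipation_w)"
    by (intro cumulative_mono dissipation_integrable dissipation_nonneg)+
  show "0 \<le> dissipation_u \<tau>" for \<tau> by (rule dissipation_nonneg)
  show "\<exists>\<tau>. a < \<tau> \<and> \<tau> < b \<and> regular \<tau> \<and> dissipation_u \<tau> * (b - a) \<le> cumulative dissipation_u b - cumulative dissipation_u a"
    if "t \<le> a" "a < b" for a b
    by (rule exists_below_mean[OF dissipation_integrable(1) AE_regular]) (use t that in auto)
  show "\<bar>variance s - variance r\<bar> \<le> cumulative dissipation_w s - cumulative dissipation_w r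
      + (s - r) * (dissipation_u r + dissipation_u s) / 2"
    if "regular r" "regular s" "r < s" for r s
    using norm_square_increment[OF that] that by (simp add: variance_eq regular_def)
  show "variance \<tau> \<le> dissipation_u \<tau>" if "regular \<tau>" for \<tau> by (rule variance_le_dissipation[OF that])
  have "(variance \<longlongrightarrow> variance t) (at t within {0..})"
    unfolding variance_eq[OF t]
    by (rule Lim_transform_eventually[OF tendsto_diff[OF norm_square_continuous[OF t] tendsto_const]])
       (auto simp: eventually_at_filter variance_eq)
  then show "(variance \<longlongrightarrow> variance t) (at_right t)"
    by (rule tendsto_within_subset) (use t in auto)
qed

lemma variance_tendsto_0: "(variance \<longlongrightarrow> 0) at_top"
proof (rule Lim_null_comparison)
  let ?D = "\<lambda>t. (cumulative dissipation_w (t + 1) - cumulative dissipation_w t)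
    + 5 * (cumulative dissipation_u (t + 1) - cumulative dissipation_u t)"
  have "(?D \<longlongrightarrow> 0 + 5 * 0) at_top"
    by (intro tendsto_intros cumulative_increment_tendsto_0 dissipation_integrable)
  then show "(?D \<longlongrightarrow> 0) at_top" by simp
  show "\<forall>\<^sub>F t in at_top. norm (variance t) \<le> ?D t"
    using eventually_ge_at_top[of 0] by eventually_elim (use variance_bound in \<open>simp add: variance_def\<close>)
qed

end

text \<open>The initial value is prescribed for some continuous representative \<open>v'\<close>. It has the same mean as \<open>v\<close>
  at a time where both coincide with \<open>u\<close>, hence at all times.\<close>

lemma weak_flow_initial_mean:
  assumes "weak_flow u w u0 v"
  shows "torus_mean (v 0) = torus_mean u0"
proof -
  interpret weak_flow u w u0 v by fact
  obtain v' where v': "continuous_representative u v'" "AE x in torus. v' 0 x = u0 x"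
    using eq unfolding weak_equation_def by blast
  interpret v': weak_flow u w u0 v' by unfold_locales (fact eq v'(1))+
  have "\<exists>t. regular t \<and> v'.regular t"
  proof (rule ccontr)
    assume none: "\<not> ?thesis"
    have "AE t in time. t \<notin> {0<..1}"
      using AE_regular v'.AE_regular by eventually_elim (use none in blast)
    then have "emeasure time {t \<in> space time. t \<in> {0<..1}} = 0" by (rule emeasure_eq_0_AE)
    moreover have "{t \<in> space time. t \<in> {0<..1}} = {0<..1 :: real}" by auto
    ultimately show False by (simp add: emeasure_time_interval)
  qed
  then obtain t where t: "regular t" "v'.regular t" by blast
  have ae: "AE x in torus. v t x = v' t x"
  proof -
    have "AE x in torus. v t x = u t x" "AE x in torus. v' t x = u t x"
      using t by (auto simp: regular_def v'.regular_def)
    then show ?thesis by eventually_elim simp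
  qed
  have "torus_mean (v 0) = torus_mean (v t)" using mean_conserved[of t] t by (simp add: regular_def)
  also have "\<dots> = torus_mean (v' t)" unfolding torus_mean_eq using ae by (rule torus.integral_cong_AE')
  also have "\<dots> = torus_mean (v' 0)" using v'.mean_conserved[of t] t by (simp add: regular_def)
  also have "\<dots> = torus_mean u0" unfolding torus_mean_eq using v'(2) by (rule torus.integral_cong_AE')
  finally show ?thesis .
qed

theorem weak_equation_convergence:
  assumes "weak_equation u w u0" "continuous_representative u v"
  shows "((\<lambda>t. norm_L2 (\<lambda>x. v t x - torus_mean u0)) \<longlongrightarrow> 0) at_top"
proof -
  interpret weak_flow u w u0 v using assms by unfold_locales
  have "((\<lambda>t. sqrt (variance t)) \<longlongrightarrow> sqrt 0) at_top"
    by (intro tendsto_real_sqrt variance_tendsto_0)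
  then show ?thesis
    by (simp add: variance_def weak_flow_initial_mean[OF weak_flow_axioms])
qed

theorem theorem2:
  fixes a :: "real \<Rightarrow> real" and a0 p \<alpha> :: real
    and u01 u02 :: "real ^ 'n \<Rightarrow> real"
    and u1 u2 v1 v2 :: "real \<Rightarrow> real ^ 'n \<Rightarrow> real"
  assumes a_C1: "a C1_differentiable_on {0<..}"
    and a_pos: "\<And>r. r > 0 \<Longrightarrow> a r > 0"
    and a0: "a0 > 0"
    and p: "p \<ge> 0"
    and a_deriv: "\<And>r. r > 0 \<Longrightarrow> a r \<ge> r * \<bar>deriv a r\<bar>"
    and a_lower: "\<And>r. r > 0 \<Longrightarrow> a r \<ge> a0 / (r powr p + r powr (- p))"
    and \<alpha>: "\<alpha> \<ge> p + 4"
    and u01_L2: "u01 \<in> L2" and u02_L2: "u02 \<in> L2"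
    and u01_nonneg: "AE x in torus. u01 x \<ge> 0"
    and u02_nonneg: "AE x in torus. u02 x \<ge> 0"
    and entropy_finite: "entropy \<alpha> u01 u02 < \<infinity>"
    and solution: "weak_solution a u01 u02 u1 u2"
    and v1: "continuous_representative u1 v1"
    and v2: "continuous_representative u2 v2"
  shows "((\<lambda>t. norm_L2 (\<lambda>x. v1 t x - torus_mean u01)) \<longlongrightarrow> 0) at_top \<and>
         ((\<lambda>t. norm_L2 (\<lambda>x. v2 t x - torus_mean u02)) \<longlongrightarrow> 0) at_top"
  using solution unfolding weak_solution_def
  by (intro conjI weak_equation_convergence[OF _ v1] weak_equation_convergence[OF _ v2]) auto

end
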